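(* Let $D$ be a principal ideal domain and let $R\supseteq D$ be an integral domain containing $D$ as a subring. If $D$ is integrally closed in $R$ and $U(R)\neq U(D)$, then $R$ is submaximal.
   Context: All rings are commutative with $1\neq 0$, and a subring of a ring contains the identity of that ring. A maximal subring of $R$ is a proper subring $S\subsetneq R$ such that there is no subring strictly between $S$ and $R$; $R$ is called submaximal if it has at least one maximal subring. $U(R)$ denotes the group of units of $R$. *)

theory Defs
  imports "HOL-Algebra.Algebra"
begin

(* The guard p \<noteq> [] is needed: the zero polynomial is the empty list, on which
   lead_coeff (= hd) is unspecified. *)
definition integral_over :: "('a, 'b) ring_scheme \<Rightarrow> 'a set \<Rightarrow> 'a \<Rightarrow> bool" where
  "integral_over R D x \<longleftrightarrow>
     (\<exists>p \<in> carrier (univ_poly R D). p \<noteq> [] \<and> lead_coeff p = \<one>\<^bsub>R\<^esub> \<and> ring.eval R p x = \<zero>\<^bsub>R\<^esub>)"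

definition integrally_closed_in :: "'a set \<Rightarrow> ('a, 'b) ring_scheme \<Rightarrow> bool" where
  "integrally_closed_in D R \<longleftrightarrow> (\<forall>x \<in> carrier R. integral_over R D x \<longrightarrow> x \<in> D)"

definition maximal_subring :: "'a set \<Rightarrow> ('a, 'b) ring_scheme \<Rightarrow> bool" where
  "maximal_subring S R \<longleftrightarrow>
     subring S R \<and> S \<subset> carrier R \<and> \<not> (\<exists>T. subring T R \<and> S \<subset> T \<and> T \<subset> carrier R)"

definition submaximal :: "('a, 'b) ring_scheme \<Rightarrow> bool" where
  "submaximal R \<longleftrightarrow> (\<exists>S. maximal_subring S R)"

end

theory Submission
  imports Defs
begin

text \<open>
  If \<open>p \<in> R\<close> is invertible and \<open>S\<close> is a subring with \<open>p \<in> S\<close>, \<open>1/p \<notin> S\<close> and \<open>S[1/p] = R\<close>, then a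
  subring containing \<open>S\<close> that is maximal among those avoiding \<open>1/p\<close> is a maximal subring of \<open>R\<close>.
  Such an \<open>S\<close> is \<open>R \<inter> V\<close> for a valuation ring \<open>V\<close> of rank one of the fraction field \<open>L\<close> of \<open>R\<close>
  with \<open>p\<close> in its maximal ideal. To get \<open>V\<close>, start with a rank one valuation ring of a subfield of \<open>L\<close>
  and extend it by Zorn's lemma: over a transcendental element by the Gauss valuation, over an
  algebraic element \<open>y\<close> by adjoining \<open>y\<close> or \<open>1/y\<close> (Chevalley).

  A starting point exists in both of the following cases, which exhaust all possibilities. Either a
  nonunit of \<open>D\<close> is invertible in \<open>R\<close>; then so is a prime \<open>p\<close> of \<open>D\<close>, and the \<open>p\<close>-adic valuation of the
  fraction field of \<open>D\<close> will do. Or a unit \<open>u\<close> of \<open>R\<close> that is not a unit of \<open>D\<close> is transcendental over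
  \<open>D\<close>, and one takes \<open>p = u\<close> with the \<open>u\<close>-adic valuation. Indeed, if \<open>u\<close> were algebraic with leading
  coefficient \<open>c\<close>, then \<open>c u\<close> would be integral, hence in \<open>D\<close>; writing \<open>u = d'/c'\<close> in lowest terms, a
  Bezout identity shows that \<open>c'\<close> and \<open>d'\<close> are invertible in \<open>R\<close>, so in \<open>D\<close>.
\<close>

section \<open>Localisations and Chevalley's lemma\<close>

text \<open>
  The last clause says that inverting \<open>p\<close> in \<open>A[1/W]\<close> gives a field, which forces the associated valuation
  to have rank one.
\<close>
definition (in ring) denominators :: "'a set \<Rightarrow> 'a \<Rightarrow> 'a set \<Rightarrow> bool" where
  "denominators A p W \<longleftrightarrow> subring A R \<and> p \<in> A \<and> W \<subseteq> A \<and> \<one> \<in> W \<and> \<zero> \<notin> W \<and>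
     (\<forall>v\<in>W. \<forall>w\<in>W. v \<otimes> w \<in> W) \<and> (\<forall>w\<in>W. \<forall>a\<in>A. w \<noteq> p \<otimes> a) \<and>
     (\<forall>a\<in>A - {\<zero>}. \<exists>b\<in>A. \<exists>w\<in>W. \<exists>n::nat. a \<otimes> b = p [^] n \<otimes> w)"

text \<open>Values at \<open>y\<close> of polynomials of degree at most \<open>n\<close> with
  coefficients in \<open>I\<close>, built in Horner form. The explicit degree bound, which
  \<open>simple_extension\<close> does not carry, is what the descent in Chevalley's lemma runs
  on.\<close>

fun (in ring) bounded_polys :: "'a set \<Rightarrow> 'a \<Rightarrow> nat \<Rightarrow> 'a set" where
  "bounded_polys I y 0 = I"
| "bounded_polys I y (Suc n) = {f \<otimes> y \<oplus> a | f a. f \<in> bounded_polys I y n \<and> a \<in> I}"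

section \<open>Polynomial expressions with coefficients in a submodule\<close>

locale submodule_in = cring R for R (structure) +
  fixes S I :: "'a set"
  assumes S: "subring S R" and I_sub: "I \<subseteq> carrier R" and zero_I: "\<zero> \<in> I"
    and add_I: "\<And>a b. a \<in> I \<Longrightarrow> b \<in> I \<Longrightarrow> a \<oplus> b \<in> I"
    and mult_I: "\<And>s a. s \<in> S \<Longrightarrow> a \<in> I \<Longrightarrow> s \<otimes> a \<in> I"
begin

lemma S_carr: "s \<in> S \<Longrightarrow> s \<in> carrier R" using subringE(1)[OF S] by auto
lemma I_carr: "s \<in> I \<Longrightarrow> s \<in> carrier R" using I_sub by auto

lemma bounded_polys_carr:
  assumes "y \<in> carrier R" shows "f \<in> bounded_polys I y n \<Longrightarrow> f \<in> carrier R"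
  using assms by (induction n arbitrary: f) (auto simp: I_carr)

lemma bounded_polys_add:
  assumes y: "y \<in> carrier R"
  shows "f \<in> bounded_polys I y n \<Longrightarrow> g \<in> bounded_polys I y n \<Longrightarrow> f \<oplus> g \<in> bounded_polys I y n"
proof (induction n arbitrary: f g)
  case 0 then show ?case by (simp add: add_I)
next
  case (Suc n)
  then obtain f' a g' b where *: "f = f' \<otimes> y \<oplus> a" "f' \<in> bounded_polys I y n" "a \<in> I"
    "g = g' \<otimes> y \<oplus> b" "g' \<in> bounded_polys I y n" "b \<in> I" by auto
  note c = bounded_polys_carr[OF y *(2)] bounded_polys_carr[OF y *(5)] I_carr[OF *(3)] I_carr[OF *(6)]
  have "f \<oplus> g = (f' \<oplus> g') \<otimes> y \<oplus> (a \<oplus> b)"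
    unfolding * using c y by algebra
  then show ?case using Suc.IH[OF *(2) *(5)] add_I[OF *(3) *(6)] by auto
qed

lemma bounded_polys_smult:
  assumes y: "y \<in> carrier R" and s: "s \<in> S"
  shows "f \<in> bounded_polys I y n \<Longrightarrow> s \<otimes> f \<in> bounded_polys I y n"
proof (induction n arbitrary: f)
  case 0 then show ?case by (simp add: mult_I s)
next
  case (Suc n)
  then obtain f' a where *: "f = f' \<otimes> y \<oplus> a" "f' \<in> bounded_polys I y n" "a \<in> I" by auto
  note c = bounded_polys_carr[OF y *(2)] I_carr[OF *(3)] S_carr[OF s]
  have "s \<otimes> f = (s \<otimes> f') \<otimes> y \<oplus> (s \<otimes> a)"
    unfolding * using c y by algebra
  then show ?case using Suc.IH[OF *(2)] mult_I[OF s *(3)] by auto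
qed

lemma bounded_polys_Suc:
  assumes y: "y \<in> carrier R"
  shows "f \<in> bounded_polys I y n \<Longrightarrow> f \<in> bounded_polys I y (Suc n)"
proof (induction n arbitrary: f)
  case 0
  have "f = \<zero> \<otimes> y \<oplus> f" using y I_carr 0 by simp
  with 0 zero_I show ?case by auto
next
  case (Suc n)
  then obtain f' a where "f = f' \<otimes> y \<oplus> a" "f' \<in> bounded_polys I y n" "a \<in> I" by auto
  with Suc.IH show ?case by (metis (mono_tags, lifting) CollectI bounded_polys.simps(2))
qed

lemma bounded_polys_shift:
  assumes y: "y \<in> carrier R"
  shows "f \<in> bounded_polys I y n \<Longrightarrow> f \<otimes> y [^] k \<in> bounded_polys I y (n + k)"
proof (induction k)
  case 0 then show ?case using bounded_polys_carr[OF y 0] by simp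
next
  case (Suc k)
  have "f \<otimes> y [^] (Suc k) = (f \<otimes> y [^] k) \<otimes> y \<oplus> \<zero>"
    using y bounded_polys_carr[OF y Suc.prems] by (simp add: m_assoc)
  with Suc zero_I show ?case by auto
qed

lemma bounded_polys_add_top:
  assumes y: "y \<in> carrier R" and c: "c \<in> I"
  shows "f \<in> bounded_polys I y n \<Longrightarrow> f \<oplus> c \<otimes> y [^] n \<in> bounded_polys I y n"
  using bounded_polys_add[OF y, of f n "c \<otimes> y [^] n"] bounded_polys_shift[OF y, of c 0 n] c by simp

text \<open>Horner form exposes the constant term. The induction pushes through it to split off the
  term of top degree, which \<open>chevalley_step\<close> then replaces.\<close>

lemma bounded_polys_top:
  assumes y: "y \<in> carrier R"
  shows "f \<in> bounded_polys I y (Suc n) \<Longrightarrow> \<exists>g\<in>bounded_polys I y n. \<exists>c\<in>I. f = g \<oplus> c \<otimes> y [^] (Suc n)"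
proof (induction n arbitrary: f)
  case 0
  then obtain c a where *: "f = c \<otimes> y \<oplus> a" "c \<in> I" "a \<in> I" by auto
  then have "f = a \<oplus> c \<otimes> y [^] (Suc 0)" using y I_carr by (simp add: a_comm)
  then show ?case using * by auto
next
  case (Suc n)
  then obtain f' a where *: "f = f' \<otimes> y \<oplus> a" "f' \<in> bounded_polys I y (Suc n)" "a \<in> I" by auto
  from Suc.IH[OF *(2)] obtain g c where g: "g \<in> bounded_polys I y n" "c \<in> I" "f' = g \<oplus> c \<otimes> y [^] (Suc n)" by auto
  have "f = (g \<otimes> y \<oplus> a) \<oplus> c \<otimes> (y [^] (Suc n) \<otimes> y)"
    unfolding *(1) g(3) using y bounded_polys_carr[OF y g(1)] I_carr[OF g(2)] I_carr[OF *(3)] nat_pow_closed[OF y, of "Suc n"]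
    by algebra
  moreover have "g \<otimes> y \<oplus> a \<in> bounded_polys I y (Suc n)" using g * by auto
  ultimately show ?case using g(2) by auto
qed

text \<open>Multiplying by \<open>y ^ n\<close> turns \<open>z ^ i\<close> into
  \<open>y ^ (n - i)\<close>, so the coefficients are reversed and stay in \<open>I\<close>.\<close>

lemma bounded_polys_reverse:
  assumes y: "y \<in> carrier R" and z: "z \<in> carrier R" and yz: "y \<otimes> z = \<one>"
  shows "f \<in> bounded_polys I z n \<Longrightarrow> f \<otimes> y [^] n \<in> bounded_polys I y n"
proof (induction n arbitrary: f)
  case 0 then show ?case using I_carr by simp
next
  case (Suc n)
  then obtain g a where *: "f = g \<otimes> z \<oplus> a" "g \<in> bounded_polys I z n" "a \<in> I" by auto
  note c = bounded_polys_carr[OF z *(2)] I_carr[OF *(3)]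
  have zy: "z \<otimes> y = \<one>" using yz y z m_comm by simp
  have "(g \<otimes> z) \<otimes> y [^] Suc n = g \<otimes> y [^] n \<otimes> (z \<otimes> y)"
    using c y z by (simp add: m_ac)
  then have "f \<otimes> y [^] Suc n = g \<otimes> y [^] n \<oplus> a \<otimes> y [^] Suc n"
    using c y z zy unfolding * by (simp add: l_distr del: nat_pow_Suc)
  then show ?case
    using bounded_polys_add_top[OF y *(3) bounded_polys_Suc[OF y Suc.IH[OF *(2)]]] by simp
qed

end

section \<open>Fields with a marked nonzero element, and Chevalley's lemma\<close>

locale pointed_field = field R for R (structure) +
  fixes p
  assumes p_closed [simp]: "p \<in> carrier R" and p_nonzero [simp]: "p \<noteq> \<zero>"
begin

lemma inv_closed_nz: "x \<in> carrier R \<Longrightarrow> x \<noteq> \<zero> \<Longrightarrow> inv x \<in> carrier R"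
  by (simp add: field_Units)
lemma r_inv_nz: "x \<in> carrier R \<Longrightarrow> x \<noteq> \<zero> \<Longrightarrow> x \<otimes> inv x = \<one>"
  by (simp add: field_Units)
lemma l_inv_nz: "x \<in> carrier R \<Longrightarrow> x \<noteq> \<zero> \<Longrightarrow> inv x \<otimes> x = \<one>"
  by (simp add: field_Units)
lemma inv_nz: "x \<in> carrier R \<Longrightarrow> x \<noteq> \<zero> \<Longrightarrow> inv x \<noteq> \<zero>"
  using l_inv_nz by fastforce
lemma inv_uniq: "x \<in> carrier R \<Longrightarrow> y \<in> carrier R \<Longrightarrow> x \<otimes> y = \<one> \<Longrightarrow> inv x = y"
  using comm_inv_char by blast
lemma pow_nz: "(p [^] (n::nat)) \<noteq> \<zero>"
  by (induction n) (auto simp: integral_iff)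

text \<open>
  The last clause says that \<open>S[1/p]\<close> is a field. Such a ring need not be a valuation ring; the
  maximal ones are.
\<close>
definition rank_one :: "'a set \<Rightarrow> bool" where
  "rank_one S \<longleftrightarrow> subring S R \<and> p \<in> S \<and> inv p \<notin> S \<and> (\<forall>a\<in>S - {\<zero>}. \<exists>b\<in>S. \<exists>n::nat. a \<otimes> b = p [^] n)"

text \<open>The ring is \<open>A[1/W]\<close>, formed inside the field as the elements that some
  \<open>w\<close> multiplies into \<open>A\<close>. It misses \<open>1/p\<close> because no
  \<open>w\<close> lies in \<open>pA\<close>, and the last clause of \<open>denominators\<close>
  becomes that of \<open>rank_one\<close> once \<open>w\<close> can be inverted.\<close>

lemma rank_one_localization:
  assumes den: "denominators A p W"
  shows "\<exists>S. rank_one S \<and> A \<subseteq> S \<and> (\<forall>w\<in>W. inv w \<in> S)"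
proof -
  have A: "subring A R" and pA: "p \<in> A" and WA: "W \<subseteq> A" and W1: "\<one> \<in> W" and W0: "\<zero> \<notin> W"
    and Wm: "\<And>v w. v \<in> W \<Longrightarrow> w \<in> W \<Longrightarrow> v \<otimes> w \<in> W" and Wp: "\<And>w a. w \<in> W \<Longrightarrow> a \<in> A \<Longrightarrow> w \<noteq> p \<otimes> a"
    and Wa: "\<And>a. a \<in> A \<Longrightarrow> a \<noteq> \<zero> \<Longrightarrow> \<exists>b\<in>A. \<exists>w\<in>W. \<exists>n::nat. a \<otimes> b = p [^] n \<otimes> w"
    using den unfolding denominators_def by auto
  note AE = subringE[OF A]
  have Ac: "a \<in> carrier R" if "a \<in> A" for a using AE(1) that by auto
  have Wc: "a \<in> carrier R" "a \<noteq> \<zero>" if "a \<in> W" for a using Ac WA W0 that by auto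
  define S where "S = {x \<in> carrier R. \<exists>w\<in>W. w \<otimes> x \<in> A}"
  have AS: "A \<subseteq> S" unfolding S_def using W1 Ac by force
  have "subring S R"
  proof (rule subringI)
    show "S \<subseteq> carrier R" unfolding S_def by auto
    show "\<one> \<in> S" using AS AE(3) by auto
    fix x assume "x \<in> S"
    then obtain w where w: "x \<in> carrier R" "w \<in> W" "w \<otimes> x \<in> A" unfolding S_def by auto
    have "w \<otimes> (\<ominus> x) = \<ominus> (w \<otimes> x)" using w Wc by (simp add: r_minus)
    then show "\<ominus> x \<in> S" unfolding S_def using w AE(5)[OF w(3)] by force
    fix y assume "y \<in> S"
    then obtain v where v: "y \<in> carrier R" "v \<in> W" "v \<otimes> y \<in> A" unfolding S_def by auto
    note c = Wc(1)[OF w(2)] Wc(1)[OF v(2)] w(1) v(1)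
    have "(w \<otimes> v) \<otimes> (x \<otimes> y) = (w \<otimes> x) \<otimes> (v \<otimes> y)" using c by algebra
    then show "x \<otimes> y \<in> S" unfolding S_def using w v AE(6) Wm by (metis (mono_tags, lifting) CollectI m_closed)
    have "(w \<otimes> v) \<otimes> (x \<oplus> y) = v \<otimes> (w \<otimes> x) \<oplus> w \<otimes> (v \<otimes> y)" using c by algebra
    also have "\<dots> \<in> A" using w v AE(6,7) WA by blast
    finally show "x \<oplus> y \<in> S" unfolding S_def using w v Wm c by auto
  qed
  moreover have "inv p \<notin> S"
  proof
    assume "inv p \<in> S"
    then obtain w where w: "w \<in> W" "w \<otimes> inv p \<in> A" unfolding S_def by auto
    have "p \<otimes> (w \<otimes> inv p) = w \<otimes> (p \<otimes> inv p)" using Wc[OF w(1)] inv_closed_nz[of p] p_closed p_nonzero by algebra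
    then show False using Wp[OF w] Wc[OF w(1)] by (simp add: r_inv_nz)
  qed
  moreover have winv: "inv w \<in> S" if "w \<in> W" for w
    unfolding S_def using that Wc[OF that] r_inv_nz inv_closed_nz AE(3) by force
  moreover have "\<exists>b\<in>S. \<exists>n::nat. x \<otimes> b = p [^] n" if x: "x \<in> S - {\<zero>}" for x
  proof -
    obtain w where w: "x \<in> carrier R" "w \<in> W" "w \<otimes> x \<in> A" using x unfolding S_def by auto
    have "w \<otimes> x \<noteq> \<zero>" using w x Wc integral_iff by auto
    from Wa[OF w(3) this] obtain b v and n :: nat where b: "b \<in> A" "v \<in> W" "(w \<otimes> x) \<otimes> b = p [^] n \<otimes> v" by blast
    note c = Wc(1)[OF w(2)] Wc(1)[OF b(2)] w(1) Ac[OF b(1)] inv_closed_nz[OF Wc[OF b(2)]] nat_pow_closed[OF p_closed, of n]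
    have "x \<otimes> (w \<otimes> b \<otimes> inv v) = ((w \<otimes> x) \<otimes> b) \<otimes> inv v" using c by algebra
    also have "\<dots> = p [^] n \<otimes> (v \<otimes> inv v)" unfolding b(3) using c by algebra
    also have "\<dots> = p [^] n" using Wc[OF b(2)] by (simp add: r_inv_nz)
    finally have "x \<otimes> (w \<otimes> b \<otimes> inv v) = p [^] n" .
    moreover have "w \<otimes> b \<otimes> inv v \<in> S"
      using winv[OF b(2)] w(2) b(1) AS WA subringE(6)[OF \<open>subring S R\<close>] by blast
    ultimately show ?thesis by blast
  qed
  ultimately show ?thesis using AS pA unfolding rank_one_def by blast
qed

text \<open>
  Multiplying the relation of smaller degree \<open>l\<close> in \<open>z = 1/y\<close> by \<open>y ^ l\<close> expresses \<open>y ^ l\<close> by lower powers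
  of \<open>y\<close>, which eliminates the leading term of the other relation.
\<close>
lemma chevalley_step:
  assumes S: "subring S R" and pS: "p \<in> S"
    and unit: "\<And>s. s \<in> S \<Longrightarrow> \<exists>t\<in>S. (\<one> \<ominus> p \<otimes> s) \<otimes> t = \<one>"
    and y: "y \<in> carrier R" and z: "z \<in> carrier R" and yz: "y \<otimes> z = \<one>" and le: "l \<le> k"
    and k: "\<one> \<in> bounded_polys ((\<otimes>) p ` S) y k" and l: "\<one> \<in> bounded_polys ((\<otimes>) p ` S) z l"
  shows "\<exists>k'<k. \<one> \<in> bounded_polys ((\<otimes>) p ` S) y k'"
proof -
  define I where "I = (\<otimes>) p ` S"
  note SE = subringE[OF S]
  have Sc: "s \<in> carrier R" if "s \<in> S" for s using SE(1) that by auto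
  interpret submodule_in R S I
  proof (intro submodule_in.intro submodule_in_axioms.intro)
    show "cring R" by unfold_locales
    show "subring S R" by fact
    show "I \<subseteq> carrier R" unfolding I_def using Sc by auto
    show "\<zero> \<in> I" unfolding I_def using SE(2) by force
    fix a b assume "a \<in> I"
    then obtain s where s: "s \<in> S" "a = p \<otimes> s" unfolding I_def by auto
    { assume "b \<in> I"
      then obtain t where t: "t \<in> S" "b = p \<otimes> t" unfolding I_def by auto
      have "a \<oplus> b = p \<otimes> (s \<oplus> t)" using s t Sc by (simp add: r_distr)
      then show "a \<oplus> b \<in> I" using s t SE(7) unfolding I_def by auto }
    { assume "b \<in> S"
      then have "b \<otimes> a = p \<otimes> (b \<otimes> s)" using s Sc by (simp add: m_lcomm)
      then show "b \<otimes> a \<in> I" using s SE(6)[OF \<open>b \<in> S\<close>] unfolding I_def by auto }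
  qed
  show ?thesis
  proof (cases l)
    case 0
    then obtain s where s: "s \<in> S" "\<one> = p \<otimes> s" using l by auto
    from unit[OF s(1)] obtain t where "t \<in> S" "(\<one> \<ominus> p \<otimes> s) \<otimes> t = \<one>" by auto
    then have False using s Sc by (metis l_null one_closed r_neg minus_eq zero_not_one)
    then show ?thesis ..
  next
    case (Suc l')
    then obtain k' where k': "k = Suc k'" "l' \<le> k'" using le Suc_le_D by auto
    from l Suc obtain g s where g: "\<one> = g \<otimes> z \<oplus> p \<otimes> s" "g \<in> bounded_polys I z l'" "s \<in> S"
      unfolding I_def by auto
    from unit[OF g(3)] obtain t where t: "t \<in> S" "(\<one> \<ominus> p \<otimes> s) \<otimes> t = \<one>" by auto
    note c = bounded_polys_carr[OF z g(2)] Sc[OF g(3)] Sc[OF t(1)] p_closed y z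
    \<comment> \<open>The relation in \<open>z\<close> reads \<open>g z = 1 - p s\<close>, and the
      right side is a unit of \<open>S\<close>. Dividing by it and multiplying by \<open>y\<close>
      solves for \<open>y\<close> as an expression in \<open>z\<close> of degree
      \<open>l'\<close>.\<close>
    have "\<one> \<ominus> p \<otimes> s = g \<otimes> z" using c unfolding g(1) by algebra
    then have "(g \<otimes> z) \<otimes> t = \<one>" using t by simp
    then have "y = y \<otimes> ((g \<otimes> z) \<otimes> t)" using y by simp
    also have "\<dots> = (y \<otimes> z) \<otimes> (t \<otimes> g)" using c by algebra
    also have "\<dots> = t \<otimes> g" using c yz by simp
    finally have ytg: "y = t \<otimes> g" .
    have "y \<in> bounded_polys I z l'" unfolding ytg using bounded_polys_smult[OF z t(1) g(2)] .
    \<comment> \<open>Reversal gives an expression of degree \<open>l'\<close> in \<open>y\<close>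
      for \<open>y ^ (l' + 1)\<close>. The extra factor \<open>y ^ (k' - l')\<close> raises the
      exponent to \<open>k\<close>, so that the top power in the other relation can be
      replaced.\<close>
    from bounded_polys_reverse[OF y z yz this] have "y \<otimes> y [^] l' \<in> bounded_polys I y l'" .
    from bounded_polys_shift[OF y this, of "k' - l'"] k'(2)
    have "y \<otimes> y [^] l' \<otimes> y [^] (k' - l') \<in> bounded_polys I y k'" by simp
    moreover have "y \<otimes> y [^] l' \<otimes> y [^] (k' - l') = y [^] Suc k'"
      using y k'(2) nat_pow_mult[OF y, of l' "k' - l'"] nat_pow_Suc2[OF y, of k'] by (simp add: m_assoc)
    ultimately have top: "y [^] Suc k' \<in> bounded_polys I y k'" by simp
    from k k'(1) have "\<one> \<in> bounded_polys I y (Suc k')" unfolding I_def by simp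
    from bounded_polys_top[OF y this] obtain h c' where h: "h \<in> bounded_polys I y k'" "c' \<in> I"
      "\<one> = h \<oplus> c' \<otimes> y [^] Suc k'" by blast
    have "c' \<in> S" using h(2) SE(6)[OF pS] unfolding I_def by auto
    have "\<one> \<in> bounded_polys I y k'"
      by (subst h(3), rule bounded_polys_add[OF y h(1) bounded_polys_smult[OF y \<open>c' \<in> S\<close> top]])
    then show ?thesis using k'(1) unfolding I_def by auto
  qed
qed

text \<open>The hypothesis \<open>unit\<close> puts \<open>p\<close> in the Jacobson radical of
  \<open>S\<close>. If \<open>1/p\<close> lay in both rings, multiplying by \<open>p\<close> would
  write \<open>1\<close> with coefficients in \<open>pS\<close>, once in \<open>y\<close> and once
  in \<open>1/y\<close>. \<open>chevalley_step\<close>, applied to the relation of larger degree,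
  lowers that degree and keeps the other, so the sum of the degrees would descend forever.\<close>

lemma chevalley:
  assumes S: "subring S R" and pS: "p \<in> S"
    and unit: "\<And>s. s \<in> S \<Longrightarrow> \<exists>t\<in>S. (\<one> \<ominus> p \<otimes> s) \<otimes> t = \<one>"
    and y: "y \<in> carrier R" "y \<noteq> \<zero>"
  shows "inv p \<notin> simple_extension S y \<or> inv p \<notin> simple_extension S (inv y)"
proof -
  have Sc: "s \<in> carrier R" if "s \<in> S" for s using subringE(1)[OF S] that by auto
  have step: "\<exists>k. \<one> \<in> bounded_polys ((\<otimes>) p ` S) x k" if x: "x \<in> carrier R" and "inv p \<in> simple_extension S x" for x
  proof -
    have "f \<in> carrier R \<and> (\<exists>k. p \<otimes> f \<in> bounded_polys ((\<otimes>) p ` S) x k)" if "f \<in> simple_extension S x" for f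
      using that
    proof (induction rule: simple_extension.induct)
      case zero
      have "p \<otimes> \<zero> \<in> (\<otimes>) p ` S" using subringE(2)[OF S] by blast
      then have "p \<otimes> \<zero> \<in> bounded_polys ((\<otimes>) p ` S) x 0" by simp
      then show ?case by blast
    next
      case (lin k1 k2)
      then obtain k where k: "p \<otimes> k1 \<in> bounded_polys ((\<otimes>) p ` S) x k" by blast
      have "p \<otimes> (k1 \<otimes> x \<oplus> k2) = (p \<otimes> k1) \<otimes> x \<oplus> p \<otimes> k2"
        using lin x Sc by (simp add: r_distr m_assoc)
      then have "p \<otimes> (k1 \<otimes> x \<oplus> k2) \<in> bounded_polys ((\<otimes>) p ` S) x (Suc k)" using k lin(2) by auto
      then show ?case using lin x Sc by blast
    qed
    from this[OF that(2)] show ?thesis by (simp add: r_inv_nz)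
  qed
  have no: False if "\<one> \<in> bounded_polys ((\<otimes>) p ` S) y k" "\<one> \<in> bounded_polys ((\<otimes>) p ` S) (inv y) l" for k l
    using that
  proof (induction "k + l" arbitrary: k l rule: less_induct)
    case less
    note iy = inv_closed_nz[OF y]
    show ?case
    proof (cases "l \<le> k")
      case True
      from chevalley_step[OF S pS unit y(1) iy r_inv_nz[OF y] True less.prems] less show False
        by (meson add_less_cancel_right)
    next
      case False
      then have "k \<le> l" by simp
      from chevalley_step[OF S pS unit iy y(1) l_inv_nz[OF y] this less.prems(2,1)] less show False
        by (meson add_less_cancel_left)
    qed
  qed
  show ?thesis using no step[OF y(1)] step[OF inv_closed_nz[OF y]] by blast
qed

end

section \<open>Unions of chains and extensions by one element\<close>

lemma (in ring) chain_Union_subring: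
  assumes "C \<noteq> {}" and chain: "subset.chain \<A> C" and sub: "\<And>S. S \<in> \<A> \<Longrightarrow> subring S R"
  shows "subring (\<Union>C) R"
proof -
  have C: "subring S R" if "S \<in> C" for S
    using chain sub that unfolding pred_on.chain_def by blast
  have both: "\<exists>S\<in>C. x \<in> S \<and> y \<in> S" if "x \<in> \<Union>C" "y \<in> \<Union>C" for x y
    using chain that unfolding pred_on.chain_def by blast
  show ?thesis
  proof (rule subringI)
    show "\<Union>C \<subseteq> carrier R" using subringE(1)[OF C] by auto
    from \<open>C \<noteq> {}\<close> obtain S where "S \<in> C" by auto
    then show "\<one> \<in> \<Union>C" using subringE(3)[OF C] by auto
    show "\<ominus> x \<in> \<Union>C" if "x \<in> \<Union>C" for x using subringE(5)[OF C] that by auto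
    fix x y assume "x \<in> \<Union>C" "y \<in> \<Union>C"
    then obtain S' where "S' \<in> C" "x \<in> S'" "y \<in> S'" using both by metis
    then show "x \<otimes> y \<in> \<Union>C" "x \<oplus> y \<in> \<Union>C" using subringE(6,7)[OF C] by blast+
  qed
qed

text \<open>\<open>M\<close> is only stable under \<open>S\<close> and need not be a ring: it will
  be the set of nonunits of \<open>S\<close>.\<close>

lemma (in ring) simple_extension_mult_subring:
  assumes "subring S R" "M \<subseteq> carrier R" "x \<in> carrier R"
    and "\<And>s m. s \<in> S \<Longrightarrow> m \<in> M \<Longrightarrow> s \<otimes> m \<in> M"
    and "s \<in> S" "f \<in> simple_extension M x"
  shows "s \<otimes> f \<in> simple_extension M x"
  using assms(6)
proof (induction rule: simple_extension.induct)
  case zero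
  then show ?case using subringE(1)[OF assms(1)] assms(5) by auto
next
  case (lin k1 k2)
  have "k1 \<in> carrier R" using lin(1) simple_extension_in_carrier[OF assms(2,3)] by blast
  then have "s \<otimes> (k1 \<otimes> x \<oplus> k2) = (s \<otimes> k1) \<otimes> x \<oplus> s \<otimes> k2"
    using subringE(1)[OF assms(1)] assms(2,3,5) lin(2) by (simp add: r_distr m_assoc subset_iff)
  then show ?case using simple_extension.lin[OF lin(3) assms(4)[OF assms(5) lin(2)]] by simp
qed

lemma (in ring) simple_extension_add:
  assumes "M \<subseteq> carrier R" "x \<in> carrier R" and add: "\<And>a b. a \<in> M \<Longrightarrow> b \<in> M \<Longrightarrow> a \<oplus> b \<in> M"
    and "f \<in> simple_extension M x" "g \<in> simple_extension M x"
  shows "f \<oplus> g \<in> simple_extension M x"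
  using assms(4,5)
proof (induction arbitrary: g rule: simple_extension.induct)
  case zero
  then show ?case using simple_extension_in_carrier[OF assms(1,2)] by auto
next
  case (lin k1 k2)
  have c: "h \<in> carrier R" if "h \<in> simple_extension M x" for h
    using that simple_extension_in_carrier[OF assms(1,2)] by blast
  have k: "k1 \<in> carrier R" "k2 \<in> carrier R" using c lin assms(1) by auto
  from lin(4) show ?case
  proof cases
    case zero
    then show ?thesis using simple_extension.lin[OF lin(1,2)] k assms(2) by simp
  next
    case (lin g1 g2)
    have g: "g1 \<in> carrier R" "g2 \<in> carrier R" using c lin assms(1) by auto
    have "(k1 \<otimes> x \<oplus> k2) \<oplus> g = (k1 \<oplus> g1) \<otimes> x \<oplus> (k2 \<oplus> g2)"
      unfolding lin(1) using k g assms(2) by algebra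
    then show ?thesis using simple_extension.lin[OF lin.IH[OF lin(2)] add[OF \<open>k2 \<in> M\<close> lin(3)]] by simp
  qed
qed

text \<open>Coefficient lists start with the leading coefficient, so \<open>q @ [a]\<close> is
  \<open>q X + a\<close>. As \<open>a\<close> is nonzero, this is a legitimate nonzero polynomial
  even for empty \<open>q\<close>.\<close>

lemma (in domain) algebraic_if_relation:
  assumes K: "subring K R" and x: "x \<in> carrier R" and f: "f \<in> simple_extension K x"
    and a: "a \<in> K" "a \<noteq> \<zero>" and rel: "f \<otimes> x \<oplus> a = \<zero>"
  shows "(algebraic over K) x"
proof -
  have Kc: "K \<subseteq> carrier R" using subringE(1)[OF K] .
  obtain q where q: "q \<in> carrier (univ_poly R K)" "f = eval q x"
    using f unfolding simple_extension_as_eval_img[OF Kc x] by auto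
  have q': "polynomial K q" using q(1) univ_poly_carrier[of R K q] by simp
  have qc: "set q \<subseteq> carrier R" using polynomial_incl[OF q'] Kc by auto
  have "polynomial K (q @ [a])"
    using q' a polynomial_incl[OF q'] unfolding polynomial_def by (cases q) auto
  moreover have "eval (q @ [a]) x = \<zero>"
    using eval_append_aux[OF qc _ x, of a] a Kc rel q(2) by auto
  ultimately show ?thesis
    using algebraicI[of "q @ [a]" K x] univ_poly_carrier[of R K "q @ [a]"] by simp
qed

context pointed_field
begin

lemma rank_one_Union:
  assumes C: "C \<noteq> {}" "subset.chain {S. rank_one S \<and> S0 \<subseteq> S} C"
  shows "rank_one (\<Union>C)" "S0 \<subseteq> \<Union>C"
proof -
  have CA: "rank_one S \<and> S0 \<subseteq> S" if "S \<in> C" for S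
    using C(2) that unfolding pred_on.chain_def by auto
  from C(1) obtain S where S: "S \<in> C" by auto
  have "subring (\<Union>C) R"
    by (rule chain_Union_subring[OF C]) (simp add: rank_one_def)
  moreover have "p \<in> \<Union>C" using S CA[OF S] unfolding rank_one_def by auto
  moreover have "inv p \<notin> \<Union>C" using CA unfolding rank_one_def by auto
  moreover have "\<exists>b\<in>\<Union>C. \<exists>n::nat. a \<otimes> b = p [^] n" if a: "a \<in> \<Union>C - {\<zero>}" for a
  proof -
    from a obtain S' where S': "S' \<in> C" "a \<in> S' - {\<zero>}" by auto
    have "\<forall>a\<in>S' - {\<zero>}. \<exists>b\<in>S'. \<exists>n::nat. a \<otimes> b = p [^] n"
      using CA[OF S'(1)] unfolding rank_one_def by simp
    then obtain b and n :: nat where "b \<in> S'" "a \<otimes> b = p [^] n"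
      using S'(2) by metis
    then show ?thesis using S'(1) by auto
  qed
  ultimately show "rank_one (\<Union>C)" unfolding rank_one_def by simp
  show "S0 \<subseteq> \<Union>C" using S CA[OF S] by auto
qed

text \<open>Zorn's lemma applies because each clause of \<open>rank_one\<close> involves only
  finitely many elements at a time, or the absence of one, and so survives unions of nonempty
  chains.\<close>

lemma rank_one_maximal:
  assumes "rank_one S0"
  obtains S where "rank_one S" "S0 \<subseteq> S" "\<And>S'. rank_one S' \<Longrightarrow> S \<subseteq> S' \<Longrightarrow> S' = S"
proof -
  let ?A = "{S. rank_one S \<and> S0 \<subseteq> S}"
  have "\<exists>S\<in>?A. \<forall>S'\<in>?A. S \<subseteq> S' \<longrightarrow> S' = S"
  proof (rule subset_Zorn_nonempty)
    show "?A \<noteq> {}" using assms by auto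
    show "\<Union>C \<in> ?A" if "C \<noteq> {}" "subset.chain ?A C" for C
      using rank_one_Union[OF that] by simp
  qed
  then obtain S where S: "S \<in> ?A" and max: "\<forall>S'\<in>?A. S \<subseteq> S' \<longrightarrow> S' = S" ..
  show thesis
  proof (rule that)
    show "rank_one S" "S0 \<subseteq> S" using S by auto
    show "S' = S" if "rank_one S'" "S \<subseteq> S'" for S'
      using max S that by auto
  qed
qed

end

section \<open>Extending rank one valuation rings to the whole field\<close>

locale maximal_rank_one = pointed_field +
  fixes S
  assumes rank_one_S: "rank_one S" and maximal_S: "\<And>S'. rank_one S' \<Longrightarrow> S \<subseteq> S' \<Longrightarrow> S' = S"
begin

text \<open>This is \<open>S[1/p]\<close>. It is a field by the last clause of
  \<open>rank_one\<close>, and the goal of the section is that it exhausts \<open>R\<close>.\<close>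

definition localized where "localized = {x \<in> carrier R. \<exists>n::nat. p [^] n \<otimes> x \<in> S}"

lemma S: "subring S R" and p_S: "p \<in> S" and inv_p_S: "inv p \<notin> S"
  and S_power: "\<And>a. a \<in> S \<Longrightarrow> a \<noteq> \<zero> \<Longrightarrow> \<exists>b\<in>S. \<exists>n::nat. a \<otimes> b = p [^] n"
  using rank_one_S unfolding rank_one_def by auto

lemmas SE = subringE[OF S]

lemma S_carr: "s \<in> S \<Longrightarrow> s \<in> carrier R" using SE(1) by auto

lemma pow_S: "p [^] (n::nat) \<in> S"
proof (induction n)
  case (Suc n)
  then show ?case using SE(6)[OF Suc p_S] by simp
qed (simp add: SE(3))

lemma S_localized: "S \<subseteq> localized"
proof
  fix s assume "s \<in> S"
  then have "p [^] (0::nat) \<otimes> s \<in> S" using S_carr by simp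
  then show "s \<in> localized" unfolding localized_def using \<open>s \<in> S\<close> S_carr by blast
qed

lemma localized_carr: "x \<in> localized \<Longrightarrow> x \<in> carrier R" unfolding localized_def by auto

lemma localized_common:
  assumes "x \<in> localized" "y \<in> localized"
  obtains n :: nat where "p [^] n \<otimes> x \<in> S" "p [^] n \<otimes> y \<in> S"
proof -
  obtain m k :: nat where mk: "p [^] m \<otimes> x \<in> S" "p [^] k \<otimes> y \<in> S" using assms unfolding localized_def by auto
  have "p [^] (m + k) \<otimes> x = p [^] k \<otimes> (p [^] m \<otimes> x)" "p [^] (m + k) \<otimes> y = p [^] m \<otimes> (p [^] k \<otimes> y)"
    using assms localized_carr by (simp_all add: nat_pow_mult[symmetric] m_ac)
  then show thesis using that[of "m + k"] SE(6)[OF pow_S mk(1), of k] SE(6)[OF pow_S mk(2), of m] by simp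
qed

lemma localized_subring: "subring localized R"
proof (rule subringI)
  show "localized \<subseteq> carrier R" using localized_carr by auto
  show "\<one> \<in> localized" using SE(3) S_localized by auto
  show "\<ominus> x \<in> localized" if "x \<in> localized" for x
  proof -
    obtain n :: nat where n: "p [^] n \<otimes> x \<in> S" using \<open>x \<in> localized\<close> unfolding localized_def by auto
    have "p [^] n \<otimes> \<ominus> x = \<ominus> (p [^] n \<otimes> x)" using localized_carr[OF that] by (simp add: r_minus)
    then have "p [^] n \<otimes> \<ominus> x \<in> S" using SE(5)[OF n] by simp
    then show ?thesis unfolding localized_def using localized_carr[OF that] by blast
  qed
  fix x y assume xy: "x \<in> localized" "y \<in> localized"
  then obtain n :: nat where n: "p [^] n \<otimes> x \<in> S" "p [^] n \<otimes> y \<in> S" by (rule localized_common)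
  note c = xy[THEN localized_carr] nat_pow_closed[OF p_closed, of n]
  have "p [^] n \<otimes> (x \<oplus> y) = p [^] n \<otimes> x \<oplus> p [^] n \<otimes> y" using c by algebra
  then have "p [^] n \<otimes> (x \<oplus> y) \<in> S" using SE(7)[OF n] by simp
  then show "x \<oplus> y \<in> localized" unfolding localized_def using c by blast
  have "p [^] (n + n) \<otimes> (x \<otimes> y) = (p [^] n \<otimes> x) \<otimes> (p [^] n \<otimes> y)"
    using c by (simp add: nat_pow_mult[symmetric] m_ac)
  then have "p [^] (n + n) \<otimes> (x \<otimes> y) \<in> S" using SE(6)[OF n] by simp
  then show "x \<otimes> y \<in> localized" unfolding localized_def using c by blast
qed

lemma localized_inv:
  assumes "x \<in> localized" "x \<noteq> \<zero>" shows "inv x \<in> localized"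
proof -
  obtain n :: nat where n: "p [^] n \<otimes> x \<in> S" using assms unfolding localized_def by auto
  have "p [^] n \<otimes> x \<noteq> \<zero>" using assms pow_nz localized_carr integral_iff by simp
  from S_power[OF n this] obtain b and k :: nat where b: "b \<in> S" "(p [^] n \<otimes> x) \<otimes> b = p [^] k" by blast
  note c = localized_carr[OF assms(1)] S_carr[OF b(1)] inv_closed_nz[OF localized_carr[OF assms(1)] assms(2)]
     nat_pow_closed[OF p_closed, of n] nat_pow_closed[OF p_closed, of k]
  have "p [^] k \<otimes> inv x = p [^] n \<otimes> b \<otimes> (x \<otimes> inv x)" unfolding b(2)[symmetric] using c by algebra
  also have "\<dots> = p [^] n \<otimes> b" using c r_inv_nz assms by simp
  finally have "p [^] k \<otimes> inv x \<in> S" using SE(6) pow_S b(1) by simp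
  then show ?thesis unfolding localized_def using c by auto
qed

lemma localized_subfield: "subfield localized R"
  by (rule subfieldI'[OF localized_subring]) (auto intro: localized_inv)

text \<open>A power of \<open>p\<close> carries each element of \<open>A\<close> into
  \<open>S\<close>, so \<open>A\<close> inherits the last clause of \<open>rank_one\<close> from
  \<open>S\<close>. Within \<open>S[1/p]\<close>, only the avoidance of \<open>1/p\<close> has to be
  checked.\<close>

lemma maximal_in_localized:
  assumes A: "subring A R" and "S \<subseteq> A" "A \<subseteq> localized" "inv p \<notin> A"
  shows "A = S"
proof (rule maximal_S)
  have "\<exists>b\<in>A. \<exists>n::nat. a \<otimes> b = p [^] n" if a: "a \<in> A - {\<zero>}" for a
  proof -
    have aT: "a \<in> localized" "a \<in> carrier R" using a \<open>A \<subseteq> localized\<close> localized_carr by auto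
    then obtain n :: nat where n: "p [^] n \<otimes> a \<in> S" unfolding localized_def by auto
    have "p [^] n \<otimes> a \<noteq> \<zero>" using a aT pow_nz integral_iff by simp
    from S_power[OF n this] obtain b and k :: nat where b: "b \<in> S" "(p [^] n \<otimes> a) \<otimes> b = p [^] k" by blast
    then have "a \<otimes> (p [^] n \<otimes> b) = p [^] k" using aT S_carr by (simp add: m_ac)
    then show ?thesis using SE(6)[OF pow_S b(1)] \<open>S \<subseteq> A\<close> by blast
  qed
  then show "rank_one A" unfolding rank_one_def using assms p_S by auto
qed fact

text \<open>Localising at the multiplicative set \<open>1 - pS\<close> gives a ring of rank one
  above \<open>S\<close>. By maximality it is \<open>S\<close> itself, so these elements were
  already invertible. This supplies the hypothesis \<open>unit\<close> of Chevalley's lemma.\<close>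

lemma one_minus_unit:
  assumes "s \<in> S" shows "\<exists>t\<in>S. (\<one> \<ominus> p \<otimes> s) \<otimes> t = \<one>"
proof -
  define W where "W = {\<one> \<ominus> p \<otimes> s | s. s \<in> S}"
  have no_inv: "p \<otimes> s \<noteq> \<one>" if "s \<in> S" for s
    using that inv_uniq[OF p_closed S_carr[OF that]] inv_p_S by auto
  have WS: "W \<subseteq> S"
    unfolding W_def using SE(3,5,6,7) p_S by (auto simp: minus_eq)
  have den: "denominators S p W" unfolding denominators_def
  proof (intro conjI ballI)
    show "subring S R" "p \<in> S" "W \<subseteq> S" by (fact S p_S WS)+
    have "\<one> = \<one> \<ominus> p \<otimes> \<zero>" by (simp add: minus_eq)
    then show W1: "\<one> \<in> W" unfolding W_def using SE(2) by blast
    have nz: "w \<noteq> p \<otimes> a" if "w \<in> W" "a \<in> S" for w a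
    proof
      assume eq: "w = p \<otimes> a"
      obtain s where s: "w = \<one> \<ominus> p \<otimes> s" "s \<in> S" using \<open>w \<in> W\<close> unfolding W_def by auto
      have "p \<otimes> (s \<oplus> a) = p \<otimes> s \<oplus> (\<one> \<ominus> p \<otimes> s)"
        using eq s S_carr[OF s(2)] S_carr[OF \<open>a \<in> S\<close>] p_closed by (simp add: r_distr)
      also have "\<dots> = \<one>" using S_carr[OF s(2)] p_closed by algebra
      finally show False using no_inv SE(7)[OF s(2) \<open>a \<in> S\<close>] by blast
    qed
    then show "w \<noteq> p \<otimes> a" if "w \<in> W" "a \<in> S" for w a using that by blast
    show "\<zero> \<notin> W" using nz[OF _ SE(2)] by auto
    show "v \<otimes> w \<in> W" if vw: "v \<in> W" "w \<in> W" for v w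
    proof -
      obtain s t where st: "v = \<one> \<ominus> p \<otimes> s" "s \<in> S" "w = \<one> \<ominus> p \<otimes> t" "t \<in> S" using vw unfolding W_def by auto
      have "v \<otimes> w = \<one> \<ominus> p \<otimes> (s \<oplus> t \<oplus> \<ominus> (p \<otimes> s \<otimes> t))"
        unfolding st using S_carr[OF st(2)] S_carr[OF st(4)] p_closed by algebra
      moreover have "s \<oplus> t \<oplus> \<ominus> (p \<otimes> s \<otimes> t) \<in> S" using st(2,4) p_S SE(5,6,7) by auto
      ultimately show ?thesis unfolding W_def by blast
    qed
    show "\<exists>b\<in>S. \<exists>w\<in>W. \<exists>n::nat. a \<otimes> b = p [^] n \<otimes> w" if a: "a \<in> S - {\<zero>}" for a
    proof -
      obtain b and n :: nat where "b \<in> S" "a \<otimes> b = p [^] n" using S_power[of a] a by blast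
      moreover have "p [^] n = p [^] n \<otimes> \<one>" by simp
      ultimately show ?thesis using W1 by metis
    qed
  qed
  from rank_one_localization[OF den] obtain S' where S': "rank_one S'" "S \<subseteq> S'" "\<forall>w\<in>W. inv w \<in> S'" by blast
  have W0: "\<zero> \<notin> W" using den unfolding denominators_def by blast
  define u where "u = \<one> \<ominus> p \<otimes> s"
  have u: "u \<in> W" unfolding W_def u_def using assms by auto
  have "u \<in> carrier R" "u \<noteq> \<zero>" using u WS S_carr W0 by auto
  then have "u \<otimes> inv u = \<one>" by (rule r_inv_nz)
  moreover have "inv u \<in> S" using S'(3) u maximal_S[OF S'(1,2)] by auto
  ultimately show ?thesis unfolding u_def by auto
qed

text \<open>By Chevalley's lemma \<open>S[t]\<close> or \<open>S[1/t]\<close> avoids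
  \<open>1/p\<close>. Both lie in \<open>S[1/p]\<close>, so \<open>maximal_in_localized\<close>
  collapses that one to \<open>S\<close>. Thus \<open>S\<close> is a valuation ring of the field
  \<open>S[1/p]\<close>.\<close>

lemma valuation_localized:
  assumes "t \<in> localized" "t \<noteq> \<zero>" shows "t \<in> S \<or> inv t \<in> S"
proof -
  have *: "x \<in> S" if "x \<in> localized" "inv p \<notin> simple_extension S x" for x
  proof -
    have x: "x \<in> carrier R" using localized_carr that by blast
    have "simple_extension S x = S"
      using maximal_in_localized[OF simple_extension_is_subring[OF S x] simple_extension_incl[OF SE(1) x] _ that(2)]
        simple_extension_subring_incl[OF localized_subring S_localized that(1)] by blast
    then show ?thesis using simple_extension_mem[OF S x] by simp
  qed
  show ?thesis
    using chevalley[OF S p_S one_minus_unit localized_carr[OF assms(1)] assms(2)] *[OF assms(1)] *[OF localized_inv[OF assms]]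
    by blast
qed

section \<open>The maximal ideal of \<open>S\<close>\<close>

definition nonunits where "nonunits = {s \<in> S. \<forall>r\<in>S. s \<otimes> r \<noteq> \<one>}"

lemma nonunits_S: "nonunits \<subseteq> S" unfolding nonunits_def by auto
lemma nonunits_carr: "nonunits \<subseteq> carrier R" using nonunits_S SE(1) by auto

lemma zero_nonunits: "\<zero> \<in> nonunits" unfolding nonunits_def using SE(2) S_carr by auto

lemma p_nonunits: "p \<in> nonunits"
  unfolding nonunits_def using p_S inv_p_S inv_uniq[OF p_closed] S_carr by blast

lemma nonunits_mult: "s \<in> S \<Longrightarrow> m \<in> nonunits \<Longrightarrow> s \<otimes> m \<in> nonunits"
proof -
  assume s: "s \<in> S" and m: "m \<in> nonunits"
  then have mS: "m \<in> S" using nonunits_S by auto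
  have "(s \<otimes> m) \<otimes> r \<noteq> \<one>" if "r \<in> S" for r
  proof -
    have "(s \<otimes> m) \<otimes> r = m \<otimes> (s \<otimes> r)" using s mS that S_carr by (simp add: m_ac)
    then show ?thesis using m SE(6)[OF s that] unfolding nonunits_def by auto
  qed
  then show ?thesis using SE(6)[OF s mS] unfolding nonunits_def by auto
qed

text \<open>The usual argument that a valuation ring is local: if \<open>a/b\<close> is in
  \<open>S\<close>, then \<open>a + b = (a/b + 1) b\<close> is a multiple of the nonunit
  \<open>b\<close>; otherwise \<open>b/a\<close> is in \<open>S\<close> and the roles are
  exchanged.\<close>

lemma nonunits_add:
  assumes a: "a \<in> nonunits" and b: "b \<in> nonunits" shows "a \<oplus> b \<in> nonunits"
proof -
  have *: "a \<oplus> b \<in> nonunits" if ab: "a \<in> nonunits" "b \<in> nonunits" "b \<noteq> \<zero>" "a \<otimes> inv b \<in> S" for a b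
  proof -
    have c: "a \<in> carrier R" "b \<in> carrier R" "inv b \<in> carrier R" using ab nonunits_carr inv_closed_nz by auto
    have "(a \<otimes> inv b \<oplus> \<one>) \<otimes> b = a \<otimes> (inv b \<otimes> b) \<oplus> b" using c by algebra
    also have "\<dots> = a \<oplus> b" using c ab l_inv_nz by simp
    finally show ?thesis using nonunits_mult[OF SE(7)[OF ab(4) SE(3)] ab(2)] by simp
  qed
  have c: "a \<in> carrier R" "b \<in> carrier R" using a b nonunits_carr by auto
  show ?thesis
  proof (cases "a = \<zero> \<or> b = \<zero>")
    case True
    then show ?thesis using a b c by auto
  next
    case False
    then have ic: "inv a \<in> carrier R" "inv b \<in> carrier R" using c inv_closed_nz by auto
    have "inv b \<in> localized" using b False localized_inv nonunits_S S_localized by blast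
    then have t: "a \<otimes> inv b \<in> localized" using a nonunits_S S_localized subringE(6)[OF localized_subring] by blast
    have "(a \<otimes> inv b) \<otimes> (b \<otimes> inv a) = (a \<otimes> inv a) \<otimes> (b \<otimes> inv b)" using c ic by algebra
    also have "\<dots> = \<one>" using c False r_inv_nz by simp
    finally have 1: "(a \<otimes> inv b) \<otimes> (b \<otimes> inv a) = \<one>" .
    then have nz: "a \<otimes> inv b \<noteq> \<zero>" using c ic by auto
    have i: "inv (a \<otimes> inv b) = b \<otimes> inv a" using inv_uniq[OF _ _ 1] c ic by simp
    from valuation_localized[OF t nz] show ?thesis
    proof
      assume "a \<otimes> inv b \<in> S" then show ?thesis using * a b False by blast
    next
      assume "inv (a \<otimes> inv b) \<in> S"
      then have "b \<oplus> a \<in> nonunits" using * a b False i by auto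
      then show ?thesis using c a_comm by simp
    qed
  qed
qed

lemma unit_diff_nonunits: "c \<in> S \<Longrightarrow> c \<notin> nonunits \<Longrightarrow> c' \<in> S \<Longrightarrow> c' \<notin> nonunits \<Longrightarrow> c \<otimes> c' \<in> S - nonunits"
proof -
  assume c: "c \<in> S" "c \<notin> nonunits" "c' \<in> S" "c' \<notin> nonunits"
  then obtain r r' where r: "r \<in> S" "c \<otimes> r = \<one>" "r' \<in> S" "c' \<otimes> r' = \<one>" unfolding nonunits_def by auto
  have "(c \<otimes> c') \<otimes> (r \<otimes> r') = (c \<otimes> r) \<otimes> (c' \<otimes> r')"
    using S_carr[OF c(1)] S_carr[OF c(3)] S_carr[OF r(1)] S_carr[OF r(3)] by algebra
  then have "(c \<otimes> c') \<otimes> (r \<otimes> r') = \<one>" using r by simp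
  then show ?thesis using SE(6)[OF c(1,3)] SE(6)[OF r(1,3)] unfolding nonunits_def by auto
qed

end

section \<open>Transcendental and algebraic elements lie in \<open>S[1/p]\<close>\<close>

context maximal_rank_one
begin

text \<open>Expressions in \<open>y\<close> with nonunit coefficients form the extension of the
  maximal ideal to \<open>S[y]\<close>. This is the ideal \<open>P\<close> behind the Gauss
  valuation below.\<close>

lemma simple_extension_closed:
  assumes y: "y \<in> carrier R" and a: "a \<in> simple_extension S y" and m: "m \<in> simple_extension nonunits y"
  shows "a \<otimes> m \<in> simple_extension nonunits y"
  using a
proof (induction rule: simple_extension.induct)
  case zero
  then show ?case using m simple_extension_in_carrier[OF nonunits_carr y] by auto
next
  case (lin k1 k2)
  have c: "k1 \<in> carrier R" "k2 \<in> carrier R" "m \<in> carrier R"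
    using lin m S_carr simple_extension_in_carrier[OF nonunits_carr y] simple_extension_in_carrier[OF SE(1) y] by auto
  have "(k1 \<otimes> y \<oplus> k2) \<otimes> m = ((k1 \<otimes> m) \<otimes> y \<oplus> \<zero>) \<oplus> k2 \<otimes> m" using c y by algebra
  moreover have "(k1 \<otimes> m) \<otimes> y \<oplus> \<zero> \<in> simple_extension nonunits y"
    by (rule simple_extension.lin[OF lin(3) zero_nonunits])
  moreover have "k2 \<otimes> m \<in> simple_extension nonunits y"
    by (rule simple_extension_mult_subring[OF S nonunits_carr y nonunits_mult lin(2) m])
  ultimately show ?case using simple_extension_add[OF nonunits_carr y nonunits_add] by simp
qed

text \<open>
  Otherwise the Gauss valuation ring of \<open>S[y]\<close> would be a strictly larger ring of rank one. \<open>W\<close> consists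
  of the polynomials with a unit coefficient; they are written without reference to coefficients,
  with \<open>c\<close> as the first one that is a unit.
\<close>
lemma transcendental_in_localized:
  assumes y: "y \<in> carrier R" "y \<noteq> \<zero>"
    and trans: "\<And>f a. f \<in> simple_extension S y \<Longrightarrow> a \<in> S \<Longrightarrow> f \<otimes> y \<oplus> a = \<zero> \<Longrightarrow> a = \<zero>"
  shows "y \<in> localized"
proof -
  define A where "A = simple_extension S y"
  define P where "P = simple_extension nonunits y"
  define W where "W = {m \<oplus> (f \<otimes> y \<oplus> c) \<otimes> y [^] i | m f c (i::nat). m \<in> P \<and> f \<in> A \<and> c \<in> S - nonunits}"
  have A: "subring A R" unfolding A_def by (rule simple_extension_is_subring[OF S y(1)])
  note AE = subringE[OF A]
  have Ac: "a \<in> carrier R" if "a \<in> A" for a using AE(1) that by auto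
  have SA: "S \<subseteq> A" unfolding A_def by (rule simple_extension_incl[OF SE(1) y(1)])
  have yA: "y \<in> A" unfolding A_def by (rule simple_extension_mem[OF S y(1)])
  have yiA: "y [^] (i::nat) \<in> A" for i
  proof (induction i)
    case (Suc i)
    then show ?case using AE(6)[OF Suc yA] by simp
  qed (simp add: AE(3))
  have PA: "P \<subseteq> A" unfolding P_def A_def by (rule mono_simple_extension[OF nonunits_S])
  have P0: "\<zero> \<in> P" unfolding P_def by auto
  have Padd: "a \<oplus> b \<in> P" if "a \<in> P" "b \<in> P" for a b
    using that simple_extension_add[OF nonunits_carr y(1) nonunits_add] unfolding P_def by blast
  have AP: "a \<otimes> m \<in> P" if "a \<in> A" "m \<in> P" for a m
    using that simple_extension_closed[OF y(1)] unfolding A_def P_def by blast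
  have MP: "nonunits \<subseteq> P" unfolding P_def by (rule simple_extension_incl[OF nonunits_carr y(1)])
  have one_unit: "\<one> \<in> S - nonunits" unfolding nonunits_def using SE(3) r_one[OF one_closed] by blast
  have WI: "m \<oplus> (f \<otimes> y \<oplus> c) \<otimes> y [^] (i::nat) \<in> W" if "m \<in> P" "f \<in> A" "c \<in> S - nonunits" for m f c i
    unfolding W_def using that by blast
  have WI0: "f \<otimes> y \<oplus> c \<in> W" if "f \<in> A" "c \<in> S - nonunits" for f c
  proof -
    have "f \<otimes> y \<oplus> c = \<zero> \<oplus> (f \<otimes> y \<oplus> c) \<otimes> y [^] (0::nat)"
      using Ac[OF that(1)] that(2) S_carr y by simp
    then show ?thesis using WI[OF P0 that, of 0] by simp
  qed
  have W1: "\<one> \<in> W" using WI0[OF AE(2) one_unit] y by simp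
  have body: "(f \<otimes> y \<oplus> c) \<in> A" if "f \<in> A" "c \<in> S" for f c
    using AE(7)[OF AE(6)[OF that(1) yA]] that(2) SA by auto
  have WA: "W \<subseteq> A"
  proof
    fix w assume "w \<in> W"
    then obtain m f c and i :: nat where w: "w = m \<oplus> (f \<otimes> y \<oplus> c) \<otimes> y [^] i" "m \<in> P" "f \<in> A" "c \<in> S"
      unfolding W_def by blast
    show "w \<in> A" unfolding w(1) using AE(7)[OF _ AE(6)[OF body[OF w(3,4)] yiA]] w(2) PA by auto
  qed
  \<comment> \<open>Gauss's lemma: terms involving \<open>m\<close> or \<open>m'\<close> fall into
    the ideal \<open>P\<close>, and the lowest coefficient of what remains is the product
    \<open>c c'\<close> of two units.\<close>
  have Wm: "v \<otimes> w \<in> W" if "v \<in> W" "w \<in> W" for v w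
  proof -
    from that obtain m f c m' f' c' and i j :: nat where
      v: "v = m \<oplus> (f \<otimes> y \<oplus> c) \<otimes> y [^] i" "m \<in> P" "f \<in> A" "c \<in> S" "c \<notin> nonunits" and
      w: "w = m' \<oplus> (f' \<otimes> y \<oplus> c') \<otimes> y [^] j" "m' \<in> P" "f' \<in> A" "c' \<in> S" "c' \<notin> nonunits"
      unfolding W_def by blast
    let ?b = "(f \<otimes> y \<oplus> c) \<otimes> y [^] i" and ?b' = "(f' \<otimes> y \<oplus> c') \<otimes> y [^] j"
    have b: "?b \<in> A" "?b' \<in> A" using AE(6)[OF body yiA] v w by auto
    have mA: "m \<in> A" "m' \<in> A" using v w PA by auto
    let ?m = "m \<otimes> m' \<oplus> (?b' \<otimes> m \<oplus> ?b \<otimes> m')"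
    have m: "?m \<in> P"
      by (intro Padd AP b mA v(2) w(2))
    let ?f = "(f \<otimes> f') \<otimes> y \<oplus> (c' \<otimes> f \<oplus> c \<otimes> f')"
    have f: "?f \<in> A" using v w SA by (intro AE(6,7) yA) auto
    have c: "f \<in> carrier R" "f' \<in> carrier R" "c \<in> carrier R" "c' \<in> carrier R"
      "m \<in> carrier R" "m' \<in> carrier R" "y [^] i \<in> carrier R" "y [^] j \<in> carrier R" "?b \<in> carrier R" "?b' \<in> carrier R"
      using v w Ac mA S_carr y(1) b by auto
    have "?b \<otimes> ?b' = (?f \<otimes> y \<oplus> c \<otimes> c') \<otimes> (y [^] i \<otimes> y [^] j)"
      using c(1-4,7,8) y(1) by algebra
    also have "\<dots> = (?f \<otimes> y \<oplus> c \<otimes> c') \<otimes> y [^] (i + j)" using y(1) by (simp add: nat_pow_mult)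
    finally have bb: "?b \<otimes> ?b' = (?f \<otimes> y \<oplus> c \<otimes> c') \<otimes> y [^] (i + j)" .
    have "(m \<oplus> x) \<otimes> (m' \<oplus> x') = (m \<otimes> m' \<oplus> (x' \<otimes> m \<oplus> x \<otimes> m')) \<oplus> x \<otimes> x'"
      if "x \<in> carrier R" "x' \<in> carrier R" for x x' using c(5,6) that by algebra
    from this[OF c(9,10)] have "v \<otimes> w = ?m \<oplus> ?b \<otimes> ?b'" unfolding v(1) w(1) .
    then show ?thesis unfolding bb using WI[OF m f unit_diff_nonunits[OF v(4,5) w(4,5)], of "i + j"] by simp
  qed
  \<comment> \<open>Two expressions for the same element are subtracted. \<open>trans\<close> kills
    the constant term of the difference, so constant coefficients are well defined.\<close>
  have P_coeff: "c \<in> nonunits" if "f \<in> A" "c \<in> S" "f \<otimes> y \<oplus> c \<in> P" for f c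
  proof -
    from that(3) have "\<exists>g a. f \<otimes> y \<oplus> c = g \<otimes> y \<oplus> a \<and> g \<in> A \<and> a \<in> nonunits"
      unfolding P_def
    proof cases
      case zero
      then have "f \<otimes> y \<oplus> c = \<zero> \<otimes> y \<oplus> \<zero>" using y by simp
      then show ?thesis using AE(2) zero_nonunits by blast
    next
      case (lin k1 k2)
      then show ?thesis using PA unfolding P_def by blast
    qed
    then obtain g a where g: "f \<otimes> y \<oplus> c = g \<otimes> y \<oplus> a" "g \<in> A" "a \<in> nonunits" by blast
    note c = Ac[OF that(1)] S_carr[OF that(2)] Ac[OF g(2)]
    have ac: "a \<in> carrier R" "a \<in> S" using g(3) nonunits_S nonunits_carr by auto
    have "(f \<oplus> \<ominus> g) \<otimes> y \<oplus> (c \<oplus> \<ominus> a) = (f \<otimes> y \<oplus> c) \<oplus> \<ominus> (g \<otimes> y \<oplus> a)" using c ac y(1) by algebra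
    also have "\<dots> = \<zero>" unfolding g(1) using c ac y(1) by algebra
    finally have "(f \<oplus> \<ominus> g) \<otimes> y \<oplus> (c \<oplus> \<ominus> a) = \<zero>" .
    moreover have "f \<oplus> \<ominus> g \<in> simple_extension S y" using AE(7)[OF that(1) AE(5)[OF g(2)]] unfolding A_def .
    moreover have "c \<oplus> \<ominus> a \<in> S" using SE(7)[OF that(2) SE(5)[OF ac(2)]] .
    ultimately have "c \<oplus> \<ominus> a = \<zero>" by (rule trans[rotated 2])
    then have "c = a" using c ac by (metis a_minus_def r_right_minus_eq)
    then show ?thesis using g(3) by simp
  qed
  \<comment> \<open>Again by \<open>trans\<close>, the constant coefficient of an element of
    \<open>P\<close> of the form \<open>q y\<close> vanishes, and cancelling \<open>y\<close> leaves
    a member of \<open>P\<close>.\<close>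
  have P_shift: "q \<in> P" if "q \<in> A" "q \<otimes> y \<in> P" for q
    using that(2) unfolding P_def
  proof cases
    case zero
    then have "q = \<zero>" using y Ac[OF that(1)] integral_iff by auto
    then show "q \<in> simple_extension nonunits y" by auto
  next
    case (lin g a)
    have gA: "g \<in> A" and aS: "a \<in> S" using lin PA nonunits_S unfolding P_def by auto
    note c = Ac[OF that(1)] Ac[OF gA] S_carr[OF aS]
    have "(g \<oplus> \<ominus> q) \<otimes> y \<oplus> a = (g \<otimes> y \<oplus> a) \<oplus> \<ominus> (q \<otimes> y)" using c y(1) by algebra
    also have "\<dots> = \<zero>" unfolding lin(1)[symmetric] using c y(1) by algebra
    finally have 0: "(g \<oplus> \<ominus> q) \<otimes> y \<oplus> a = \<zero>" .
    have gq: "g \<oplus> \<ominus> q \<in> simple_extension S y" using AE(7)[OF gA AE(5)[OF that(1)]] unfolding A_def .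
    have "a = \<zero>" by (rule trans[OF gq aS 0])
    then have "g \<otimes> y = q \<otimes> y" using lin(1) c y by simp
    then have "g = q" using c y m_rcancel by blast
    then show "q \<in> simple_extension nonunits y" using lin(2) by simp
  qed
  \<comment> \<open>After subtracting \<open>m\<close>, powers of \<open>y\<close> are cancelled
    with \<open>P_shift\<close> until \<open>f y + c\<close> remains in \<open>P\<close>. Then
    \<open>P_coeff\<close> contradicts that \<open>c\<close> is a unit.\<close>
  have W_P: "w \<notin> P" if "w \<in> W" for w
  proof
    assume wP: "w \<in> P"
    from that obtain m f c and i :: nat where w: "w = m \<oplus> (f \<otimes> y \<oplus> c) \<otimes> y [^] i" "m \<in> P" "f \<in> A" "c \<in> S" "c \<notin> nonunits"
      unfolding W_def by blast
    have b: "(f \<otimes> y \<oplus> c) \<otimes> y [^] j \<in> A" for j :: nat using AE(6)[OF body yiA] w by auto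
    have mA: "m \<in> A" using w(2) PA by auto
    have "(\<ominus> \<one>) \<otimes> m \<oplus> w = (f \<otimes> y \<oplus> c) \<otimes> y [^] i"
      unfolding w(1) using Ac[OF mA] Ac[OF b[of i]] by algebra
    moreover have "(\<ominus> \<one>) \<otimes> m \<oplus> w \<in> P" using Padd[OF AP[OF AE(5)[OF AE(3)] w(2)] wP] .
    ultimately have "(f \<otimes> y \<oplus> c) \<otimes> y [^] i \<in> P" by simp
    then show False
    proof (induction i)
      case 0
      then have "f \<otimes> y \<oplus> c \<in> P" using Ac[OF body[OF w(3,4)]] by simp
      then show False using P_coeff[OF w(3,4)] w(5) by simp
    next
      case (Suc j)
      have "((f \<otimes> y \<oplus> c) \<otimes> y [^] j) \<otimes> y \<in> P" using Suc.prems Ac[OF body[OF w(3,4)]] y(1) by (simp add: m_assoc)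
      then show False using Suc.IH P_shift[OF b] by blast
    qed
  qed
  \<comment> \<open>\<open>c\<close> is the content of \<open>h\<close>.\<close>
  have content: "h = \<zero> \<or> (\<exists>c\<in>S - {\<zero>}. \<exists>w\<in>W. h = c \<otimes> w)" if "h \<in> A" for h
    using that unfolding A_def
  proof (induction rule: simple_extension.induct)
    case (lin k1 k2)
    then have k1A: "k1 \<in> A" unfolding A_def by simp
    note k = Ac[OF k1A] S_carr[OF lin(2)]
    show ?case
    proof (cases "k1 = \<zero>")
      case True
      then have "k1 \<otimes> y \<oplus> k2 = k2 \<otimes> \<one>" using k y by simp
      moreover have "k2 \<otimes> \<one> = \<zero>" if "k2 = \<zero>" using that by simp
      ultimately show ?thesis using W1 lin(2) by (metis DiffI singletonD)
    next
      case False
      with lin(3) obtain c w where cw: "c \<in> S" "c \<noteq> \<zero>" "w \<in> W" "k1 = c \<otimes> w" by auto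
      note cc = S_carr[OF cw(1)]
      have wA: "w \<in> A" using cw(3) WA by auto
      note wc = Ac[OF wA] inv_closed_nz[OF cc cw(2)]
      \<comment> \<open>\<open>t\<close> compares the new constant coefficient \<open>k2\<close>
        with the content \<open>c\<close> of \<open>k1\<close>. It lies in the field
        \<open>S[1/p]\<close>, so \<open>t\<close> or \<open>1/t\<close> is in \<open>S\<close>, and
        accordingly \<open>c\<close> or \<open>k2\<close> is the content of the new
        expression.\<close>
      define t where "t = k2 \<otimes> inv c"
      have tc: "t \<in> carrier R" unfolding t_def using k wc by simp
      have "c \<otimes> t = k2 \<otimes> (c \<otimes> inv c)" unfolding t_def using cc wc k by algebra
      then have ct: "c \<otimes> t = k2" using r_inv_nz[OF cc cw(2)] k by simp
      have tT: "t \<in> localized" unfolding t_def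
        using subringE(6)[OF localized_subring] localized_inv[of c] lin(2) cw(1,2) S_localized by auto
      show ?thesis
      proof (cases "t \<in> S")
        case True
        have "k1 \<otimes> y \<oplus> k2 = c \<otimes> (w \<otimes> y \<oplus> t)"
          unfolding cw(4) ct[symmetric] using cc wc tc y(1) by algebra
        moreover have "w \<otimes> y \<oplus> t \<in> W"
        proof (cases "t \<in> nonunits")
          case False
          then show ?thesis using WI0[OF wA] True by simp
        next
          case tM: True
          from cw(3) obtain m f d and i :: nat where
            w: "w = m \<oplus> (f \<otimes> y \<oplus> d) \<otimes> y [^] i" "m \<in> P" "f \<in> A" "d \<in> S" "d \<notin> nonunits"
            unfolding W_def by blast
          have c': "m \<in> carrier R" "f \<otimes> y \<oplus> d \<in> carrier R" "y [^] i \<in> carrier R"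
            using w(2) PA Ac Ac[OF body[OF w(3,4)]] y(1) by auto
          have "w \<otimes> y \<oplus> t = (y \<otimes> m \<oplus> t) \<oplus> (f \<otimes> y \<oplus> d) \<otimes> (y [^] i \<otimes> y)"
            unfolding w(1) using c' y(1) tc by algebra
          moreover have "y \<otimes> m \<oplus> t \<in> P" using Padd[OF AP[OF yA w(2)]] tM MP by auto
          ultimately show ?thesis using WI[of _ f d "Suc i"] w by simp
        qed
        ultimately show ?thesis using cw(1,2) by blast
      next
        case False
        then have tnz: "t \<noteq> \<zero>" using SE(2) by auto
        then have it: "inv t \<in> S" using valuation_localized[OF tT] False by auto
        have "k2 \<noteq> \<zero>" using ct tnz cw(2) cc tc integral_iff by auto
        moreover have "k1 \<otimes> y \<oplus> k2 = k2 \<otimes> ((inv t \<otimes> w) \<otimes> y \<oplus> \<one>)"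
        proof -
          have "k2 \<otimes> ((inv t \<otimes> w) \<otimes> y \<oplus> \<one>) = (t \<otimes> inv t) \<otimes> ((c \<otimes> w) \<otimes> y) \<oplus> k2"
            unfolding ct[symmetric] using cc tc wc y(1) S_carr[OF it] by algebra
          then show ?thesis using r_inv_nz[OF tc tnz] cw(4) cc wc y by simp
        qed
        moreover have "(inv t \<otimes> w) \<otimes> y \<oplus> \<one> \<in> W"
          using WI0[OF AE(6)[OF _ wA] one_unit] it SA by auto
        ultimately show ?thesis using lin(2) by blast
      qed
    qed
  qed simp
  have "denominators A p W" unfolding denominators_def
  proof (intro conjI ballI)
    show "subring A R" "W \<subseteq> A" "\<one> \<in> W" by (fact A WA W1)+
    show "p \<in> A" using p_S SA by auto
    show "\<zero> \<notin> W" using W_P P0 by auto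
    show "v \<otimes> w \<in> W" if "v \<in> W" "w \<in> W" for v w using Wm[OF that] .
    show "w \<noteq> p \<otimes> a" if w: "w \<in> W" and a: "a \<in> A" for w a
    proof
      assume "w = p \<otimes> a"
      moreover have "a \<otimes> p \<in> P" using AP[OF a] p_nonunits MP by auto
      ultimately show False using W_P[OF w] Ac[OF a] m_comm by simp
    qed
    show "\<exists>b\<in>A. \<exists>w\<in>W. \<exists>n::nat. a \<otimes> b = p [^] n \<otimes> w" if a: "a \<in> A - {\<zero>}" for a
    proof -
      from content[of a] a obtain c w where cw: "c \<in> S" "c \<noteq> \<zero>" "w \<in> W" "a = c \<otimes> w" by auto
      from S_power[OF cw(1,2)] obtain b and n :: nat where b: "b \<in> S" "c \<otimes> b = p [^] n" by auto
      have "a \<otimes> b = (c \<otimes> b) \<otimes> w"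
        unfolding cw(4) using S_carr[OF cw(1)] S_carr[OF b(1)] Ac cw(3) WA by (simp add: m_ac subset_iff)
      then show ?thesis using b cw(3) SA by auto
    qed
  qed
  from rank_one_localization[OF this] obtain S' where "rank_one S'" "A \<subseteq> S'" by auto
  then have "A \<subseteq> S" using maximal_S[of S'] SA by auto
  then show ?thesis using yA S_localized by auto
qed

text \<open>If \<open>S[x]\<close> avoids \<open>1/p\<close> for an algebraic \<open>x\<close>, it
  is a ring of rank one: inverses exist in the field \<open>S[1/p][x]\<close>, and a power of
  \<open>p\<close> carries them into \<open>S[x]\<close>. Maximality then puts \<open>x\<close> in
  \<open>S\<close>. Chevalley's lemma provides the assumption for \<open>y\<close> or for
  \<open>1/y\<close>, which is algebraic too.\<close>

lemma algebraic_in_localized: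
  assumes y: "y \<in> carrier R" "y \<noteq> \<zero>" and alg: "(algebraic over localized) y"
  shows "y \<in> localized"
proof -
  have *: "x \<in> S" if x: "x \<in> carrier R" "(algebraic over localized) x" "inv p \<notin> simple_extension S x" for x
  proof -
    define A where "A = simple_extension S x"
    have A: "subring A R" unfolding A_def by (rule simple_extension_is_subring[OF S x(1)])
    have SA: "S \<subseteq> A" unfolding A_def by (rule simple_extension_incl[OF SE(1) x(1)])
    have F: "subfield (simple_extension localized x) R"
      using simple_extension_is_subfield[OF localized_subfield x(1)] x(2) by simp
    have clear: "\<exists>n::nat. p [^] n \<otimes> g \<in> A" if "g \<in> simple_extension localized x" for g
      using that
    proof (induction rule: simple_extension.induct)
      case zero
      have "p [^] (0::nat) \<otimes> \<zero> \<in> A" using subringE(2)[OF A] by simp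
      then show ?case by blast
    next
      case (lin k1 k2)
      then obtain n m :: nat where nm: "p [^] n \<otimes> k1 \<in> A" "p [^] m \<otimes> k2 \<in> S" unfolding localized_def by auto
      have k: "k1 \<in> carrier R" "k2 \<in> carrier R"
        using lin localized_carr simple_extension_in_carrier[OF subfieldE(3)[OF localized_subfield] x(1)] by auto
      note c = k x(1) nat_pow_closed[OF p_closed, of n] nat_pow_closed[OF p_closed, of m]
      have "p [^] (n + m) \<otimes> (k1 \<otimes> x \<oplus> k2) = (p [^] n \<otimes> p [^] m) \<otimes> (k1 \<otimes> x \<oplus> k2)" by (simp add: nat_pow_mult)
      also have "\<dots> = p [^] m \<otimes> (p [^] n \<otimes> k1) \<otimes> x \<oplus> p [^] n \<otimes> (p [^] m \<otimes> k2)"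
        using c by algebra
      also have "\<dots> \<in> A"
      proof -
        have "p [^] m \<in> A" "p [^] n \<in> A" "x \<in> A"
          using pow_S SA simple_extension_mem[OF S x(1)] unfolding A_def by auto
        moreover have "p [^] m \<otimes> k2 \<in> A" using nm(2) SA by auto
        ultimately show ?thesis
          using subringE(7)[OF A subringE(6)[OF A subringE(6)[OF A _ nm(1)]] subringE(6)[OF A]] by blast
      qed
      finally show ?case by blast
    qed
    have "rank_one A" unfolding rank_one_def
    proof (intro conjI ballI A)
      show "p \<in> A" "inv p \<notin> A" using p_S SA x(3) unfolding A_def by auto
      fix a assume a: "a \<in> A - {\<zero>}"
      then have ac: "a \<in> carrier R" using subringE(1)[OF A] by auto
      have "a \<in> simple_extension localized x - {\<zero>}" using a mono_simple_extension[OF S_localized, of x] unfolding A_def by auto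
      from subfield_m_inv[OF F this] have i: "inv a \<in> simple_extension localized x" "a \<otimes> inv a = \<one>" by auto
      from clear[OF i(1)] obtain n :: nat where n: "p [^] n \<otimes> inv a \<in> A" by auto
      have "a \<otimes> (p [^] n \<otimes> inv a) = p [^] n \<otimes> (a \<otimes> inv a)"
        using ac inv_closed_nz[OF ac] a by (simp add: m_lcomm)
      then show "\<exists>b\<in>A. \<exists>n::nat. a \<otimes> b = p [^] n" using n i(2) by auto
    qed
    from maximal_S[OF this SA] show ?thesis using simple_extension_mem[OF S x(1)] unfolding A_def by simp
  qed
  have "inv y \<in> {x \<in> carrier R. (algebraic over localized) x}"
    using subfield_m_inv(1)[OF subfield_of_algebraics[OF localized_subfield], of y] y alg by auto
  then have iy: "inv y \<in> carrier R" "(algebraic over localized) (inv y)" by auto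
  from chevalley[OF S p_S one_minus_unit y] show ?thesis
  proof
    assume "inv p \<notin> simple_extension S y"
    then show ?thesis using *[OF y(1) alg] S_localized by auto
  next
    assume "inv p \<notin> simple_extension S (inv y)"
    then have "inv y \<in> localized" using *[OF iy] S_localized by auto
    from localized_inv[OF this inv_nz[OF y]] show ?thesis
      using inv_uniq[OF iy(1) y(1) l_inv_nz[OF y]] by simp
  qed
qed

text \<open>If the hypothesis of \<open>transcendental_in_localized\<close> fails, there is a
  relation over \<open>S\<close> with nonzero constant term, and that makes \<open>y\<close>
  algebraic over \<open>S[1/p]\<close>.\<close>

lemma localized_eq_carrier: "localized = carrier R"
proof (rule subset_antisym)
  show "carrier R \<subseteq> localized"
  proof
    fix y assume y: "y \<in> carrier R"
    show "y \<in> localized"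
    proof (cases "y = \<zero>")
      case True
      then show ?thesis using SE(2) S_localized by auto
    next
      case False
      show ?thesis
      proof (cases "\<exists>f a. f \<in> simple_extension S y \<and> a \<in> S \<and> f \<otimes> y \<oplus> a = \<zero> \<and> a \<noteq> \<zero>")
        case True
        then obtain f a where fa: "f \<in> simple_extension localized y" "a \<in> localized" "a \<noteq> \<zero>" "f \<otimes> y \<oplus> a = \<zero>"
          using mono_simple_extension[OF S_localized, of y] S_localized by blast
        show ?thesis
          by (rule algebraic_in_localized[OF y False algebraic_if_relation[OF localized_subring y fa]])
      next
        case none: False
        show ?thesis by (rule transcendental_in_localized[OF y False]) (use none in blast)
      qed
    qed
  qed
qed (use localized_carr in auto)

end

text \<open>The final clause is \<open>S[1/p] = R\<close>. In this form the property descends to any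
  subring containing \<open>p\<close>.\<close>

lemma (in pointed_field) rank_one_extension:
  assumes "denominators A p W"
  obtains S where "subring S R" "A \<subseteq> S" "inv p \<notin> S" "\<And>x. x \<in> carrier R \<Longrightarrow> \<exists>n::nat. p [^] n \<otimes> x \<in> S"
proof -
  obtain S0 where S0: "rank_one S0" "A \<subseteq> S0" using rank_one_localization[OF assms] by auto
  obtain S where S: "rank_one S" "S0 \<subseteq> S" and max: "\<And>S'. rank_one S' \<Longrightarrow> S \<subseteq> S' \<Longrightarrow> S' = S"
    using rank_one_maximal[OF S0(1)] by auto
  interpret m: maximal_rank_one R p S
    by (intro maximal_rank_one.intro maximal_rank_one_axioms.intro pointed_field_axioms S(1) max)
  show thesis
  proof (rule that)
    show "subring S R" "inv p \<notin> S" by (fact m.S m.inv_p_S)+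
    show "A \<subseteq> S" using S0(2) S(2) by auto
    show "\<exists>n::nat. p [^] n \<otimes> x \<in> S" if "x \<in> carrier R" for x
      using that m.localized_eq_carrier unfolding m.localized_def by auto
  qed
qed

section \<open>The fraction field\<close>

context domain
begin

text \<open>A fraction is the set of all pairs that represent it, so that equality of fractions is
  equality of sets.\<close>

definition fraction :: "'a \<Rightarrow> 'a \<Rightarrow> ('a \<times> 'a) set" where
  "fraction a b = {(c, d). c \<in> carrier R \<and> d \<in> carrier R - {\<zero>} \<and> a \<otimes> d = c \<otimes> b}"

definition fraction_rep :: "('a \<times> 'a) set \<Rightarrow> 'a \<times> 'a" where
  "fraction_rep u = (SOME x. x \<in> u)"

text \<open>The operations act on chosen representatives; \<open>fraction_mult\<close> and
  \<open>fraction_add\<close> show that the choice does not matter.\<close>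

definition fraction_field :: "('a \<times> 'a) set ring" where
  "fraction_field = \<lparr>
     carrier = {fraction a b | a b. a \<in> carrier R \<and> b \<in> carrier R - {\<zero>}},
     monoid.mult = (\<lambda>u v. case (fraction_rep u, fraction_rep v) of ((a, b), (c, d)) \<Rightarrow> fraction (a \<otimes> c) (b \<otimes> d)),
     one = fraction \<one> \<one>, ring.zero = fraction \<zero> \<one>,
     ring.add = (\<lambda>u v. case (fraction_rep u, fraction_rep v) of ((a, b), (c, d)) \<Rightarrow> fraction (a \<otimes> d \<oplus> c \<otimes> b) (b \<otimes> d))\<rparr>"

lemma fraction_eq_iff:
  assumes "a \<in> carrier R" "b \<in> carrier R - {\<zero>}" "c \<in> carrier R" "d \<in> carrier R - {\<zero>}"
  shows "fraction a b = fraction c d \<longleftrightarrow> a \<otimes> d = c \<otimes> b"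
proof
  assume "fraction a b = fraction c d"
  moreover have "(c, d) \<in> fraction c d" unfolding fraction_def using assms by simp
  ultimately show "a \<otimes> d = c \<otimes> b" unfolding fraction_def by auto
next
  \<comment> \<open>Transitivity of cross multiplication, by cancelling the middle denominator
    \<open>d\<close>; both directions below follow from it.\<close>
  have half: "a \<otimes> f = e \<otimes> b"
    if c: "a \<in> carrier R" "b \<in> carrier R" "c \<in> carrier R" "d \<in> carrier R" "d \<noteq> \<zero>" "e \<in> carrier R" "f \<in> carrier R"
      and eq: "a \<otimes> d = c \<otimes> b" "c \<otimes> f = e \<otimes> d" for a b c d e f
  proof -
    have "d \<otimes> (a \<otimes> f) = (a \<otimes> d) \<otimes> f" using c by algebra
    also have "\<dots> = (c \<otimes> f) \<otimes> b" unfolding eq(1) using c by algebra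
    also have "\<dots> = d \<otimes> (e \<otimes> b)" unfolding eq(2) using c by algebra
    finally show ?thesis using m_lcancel[of d "a \<otimes> f" "e \<otimes> b"] c by simp
  qed
  assume eq: "a \<otimes> d = c \<otimes> b"
  show "fraction a b = fraction c d"
  proof (rule Set.set_eqI)
    fix x :: "'a \<times> 'a"
    obtain e f where x: "x = (e, f)" by (cases x)
    have "a \<otimes> f = e \<otimes> b \<longleftrightarrow> c \<otimes> f = e \<otimes> d" if "e \<in> carrier R" "f \<in> carrier R"
    proof
      assume "a \<otimes> f = e \<otimes> b"
      show "c \<otimes> f = e \<otimes> d"
        by (rule half[of c d a b e f]) (use assms that eq \<open>a \<otimes> f = e \<otimes> b\<close> in simp_all)
    next
      assume "c \<otimes> f = e \<otimes> d"
      show "a \<otimes> f = e \<otimes> b"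
        by (rule half[of a b c d e f]) (use assms that eq \<open>c \<otimes> f = e \<otimes> d\<close> in simp_all)
    qed
    then show "x \<in> fraction a b \<longleftrightarrow> x \<in> fraction c d"
      unfolding x fraction_def by auto
  qed
qed

lemma fraction_rep:
  assumes "a \<in> carrier R" "b \<in> carrier R - {\<zero>}"
  obtains c d where "fraction_rep (fraction a b) = (c, d)" "c \<in> carrier R" "d \<in> carrier R - {\<zero>}" "a \<otimes> d = c \<otimes> b"
proof -
  have "(a, b) \<in> fraction a b" unfolding fraction_def using assms by simp
  then have "fraction_rep (fraction a b) \<in> fraction a b" unfolding fraction_rep_def by (rule someI)
  then obtain c d where cd: "fraction_rep (fraction a b) = (c, d)" "(c, d) \<in> fraction a b"
    by (cases "fraction_rep (fraction a b)") simp
  show thesis by (rule that[OF cd(1)]) (use cd(2) in \<open>simp_all add: fraction_def\<close>)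
qed

lemma nonzero_mult: "b \<in> carrier R - {\<zero>} \<Longrightarrow> d \<in> carrier R - {\<zero>} \<Longrightarrow> b \<otimes> d \<in> carrier R - {\<zero>}"
  using integral by auto

lemma fraction_mult:
  assumes ab: "a \<in> carrier R" "b \<in> carrier R - {\<zero>}" and cd: "c \<in> carrier R" "d \<in> carrier R - {\<zero>}"
  shows "fraction a b \<otimes>\<^bsub>fraction_field\<^esub> fraction c d = fraction (a \<otimes> c) (b \<otimes> d)"
proof -
  obtain a' b' where 1: "fraction_rep (fraction a b) = (a', b')" "a' \<in> carrier R" "b' \<in> carrier R - {\<zero>}" "a \<otimes> b' = a' \<otimes> b"
    using fraction_rep[OF ab] .
  obtain c' d' where 2: "fraction_rep (fraction c d) = (c', d')" "c' \<in> carrier R" "d' \<in> carrier R - {\<zero>}" "c \<otimes> d' = c' \<otimes> d"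
    using fraction_rep[OF cd] .
  have c: "a \<in> carrier R" "b \<in> carrier R" "c \<in> carrier R" "d \<in> carrier R"
    "a' \<in> carrier R" "b' \<in> carrier R" "c' \<in> carrier R" "d' \<in> carrier R" using 1 2 ab cd by auto
  have "(a' \<otimes> c') \<otimes> (b \<otimes> d) = (a' \<otimes> b) \<otimes> (c' \<otimes> d)" using c by algebra
  also have "\<dots> = (a \<otimes> c) \<otimes> (b' \<otimes> d')" unfolding 1(4)[symmetric] 2(4)[symmetric] using c by algebra
  finally have "fraction (a' \<otimes> c') (b' \<otimes> d') = fraction (a \<otimes> c) (b \<otimes> d)"
    using fraction_eq_iff[of "a' \<otimes> c'" "b' \<otimes> d'" "a \<otimes> c" "b \<otimes> d"] nonzero_mult 1(3) 2(3) ab cd c by auto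
  then show ?thesis unfolding fraction_field_def by (simp add: 1(1) 2(1))
qed

lemma fraction_add:
  assumes ab: "a \<in> carrier R" "b \<in> carrier R - {\<zero>}" and cd: "c \<in> carrier R" "d \<in> carrier R - {\<zero>}"
  shows "fraction a b \<oplus>\<^bsub>fraction_field\<^esub> fraction c d = fraction (a \<otimes> d \<oplus> c \<otimes> b) (b \<otimes> d)"
proof -
  obtain a' b' where 1: "fraction_rep (fraction a b) = (a', b')" "a' \<in> carrier R" "b' \<in> carrier R - {\<zero>}" "a \<otimes> b' = a' \<otimes> b"
    using fraction_rep[OF ab] .
  obtain c' d' where 2: "fraction_rep (fraction c d) = (c', d')" "c' \<in> carrier R" "d' \<in> carrier R - {\<zero>}" "c \<otimes> d' = c' \<otimes> d"
    using fraction_rep[OF cd] .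
  have c: "a \<in> carrier R" "b \<in> carrier R" "c \<in> carrier R" "d \<in> carrier R"
    "a' \<in> carrier R" "b' \<in> carrier R" "c' \<in> carrier R" "d' \<in> carrier R" using 1 2 ab cd by auto
  have "(a' \<otimes> d' \<oplus> c' \<otimes> b') \<otimes> (b \<otimes> d) = (a' \<otimes> b) \<otimes> (d' \<otimes> d) \<oplus> (c' \<otimes> d) \<otimes> (b' \<otimes> b)" using c by algebra
  also have "\<dots> = (a \<otimes> d \<oplus> c \<otimes> b) \<otimes> (b' \<otimes> d')" unfolding 1(4)[symmetric] 2(4)[symmetric] using c by algebra
  finally have "fraction (a' \<otimes> d' \<oplus> c' \<otimes> b') (b' \<otimes> d') = fraction (a \<otimes> d \<oplus> c \<otimes> b) (b \<otimes> d)"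
    using fraction_eq_iff[of "a' \<otimes> d' \<oplus> c' \<otimes> b'" "b' \<otimes> d'" "a \<otimes> d \<oplus> c \<otimes> b" "b \<otimes> d"] nonzero_mult 1(3) 2(3) ab cd c by auto
  then show ?thesis unfolding fraction_field_def by (simp add: 1(1) 2(1))
qed

lemma fraction_fieldE:
  assumes "u \<in> carrier fraction_field"
  obtains a b where "u = fraction a b" "a \<in> carrier R" "b \<in> carrier R - {\<zero>}"
  using assms unfolding fraction_field_def by auto

lemma fraction_closed:
  "a \<in> carrier R \<Longrightarrow> b \<in> carrier R - {\<zero>} \<Longrightarrow> fraction a b \<in> carrier fraction_field"
  unfolding fraction_field_def by auto

lemma one_nonzero: "\<one> \<in> carrier R - {\<zero>}" by simp

lemma fraction_one: "\<one>\<^bsub>fraction_field\<^esub> = fraction \<one> \<one>"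
  and fraction_zero: "\<zero>\<^bsub>fraction_field\<^esub> = fraction \<zero> \<one>"
  unfolding fraction_field_def by simp_all

lemma fraction_field_cring: "cring fraction_field"
proof (rule cringI)
  note [simp] = fraction_one fraction_zero
  show "abelian_group fraction_field"
  proof (rule abelian_groupI)
    show "\<zero>\<^bsub>fraction_field\<^esub> \<in> carrier fraction_field" using fraction_closed one_nonzero by simp
    fix u assume "u \<in> carrier fraction_field"
    then obtain a b where u: "u = fraction a b" "a \<in> carrier R" "b \<in> carrier R - {\<zero>}" by (rule fraction_fieldE)
    note uc = u(2) DiffD1[OF u(3)]
    show "\<zero>\<^bsub>fraction_field\<^esub> \<oplus>\<^bsub>fraction_field\<^esub> u = u"
      using u one_nonzero by (simp add: fraction_add)
    have "fraction (\<ominus> a) b \<oplus>\<^bsub>fraction_field\<^esub> u = fraction (\<ominus> a \<otimes> b \<oplus> a \<otimes> b) (b \<otimes> b)"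
      unfolding u(1) by (rule fraction_add) (use u in auto)
    also have "\<dots> = \<zero>\<^bsub>fraction_field\<^esub>"
    proof -
      have "(\<ominus> a \<otimes> b \<oplus> a \<otimes> b) \<otimes> \<one> = \<zero> \<otimes> (b \<otimes> b)" using uc by algebra
      then show ?thesis
        using fraction_eq_iff[of "\<ominus> a \<otimes> b \<oplus> a \<otimes> b" "b \<otimes> b" \<zero> \<one>] nonzero_mult[OF u(3) u(3)] uc by simp
    qed
    finally show "\<exists>v\<in>carrier fraction_field. v \<oplus>\<^bsub>fraction_field\<^esub> u = \<zero>\<^bsub>fraction_field\<^esub>"
      using fraction_closed[of "\<ominus> a" b] u by blast
    fix v assume "v \<in> carrier fraction_field"
    then obtain c d where v: "v = fraction c d" "c \<in> carrier R" "d \<in> carrier R - {\<zero>}" by (rule fraction_fieldE)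
    note vc = v(2) DiffD1[OF v(3)]
    have bd: "b \<otimes> d \<in> carrier R - {\<zero>}" by (rule nonzero_mult[OF u(3) v(3)])
    show "u \<oplus>\<^bsub>fraction_field\<^esub> v \<in> carrier fraction_field"
      unfolding u(1) v(1) fraction_add[OF u(2,3) v(2,3)] by (rule fraction_closed[OF _ bd]) (use uc vc in simp)
    have "a \<otimes> d \<oplus> c \<otimes> b = c \<otimes> b \<oplus> a \<otimes> d" "b \<otimes> d = d \<otimes> b" using uc vc by algebra+
    then show "u \<oplus>\<^bsub>fraction_field\<^esub> v = v \<oplus>\<^bsub>fraction_field\<^esub> u"
      unfolding u(1) v(1) fraction_add[OF u(2,3) v(2,3)] fraction_add[OF v(2,3) u(2,3)] by simp
    fix w assume "w \<in> carrier fraction_field"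
    then obtain e f where w: "w = fraction e f" "e \<in> carrier R" "f \<in> carrier R - {\<zero>}" by (rule fraction_fieldE)
    note wc = w(2) DiffD1[OF w(3)]
    have df: "d \<otimes> f \<in> carrier R - {\<zero>}" by (rule nonzero_mult[OF v(3) w(3)])
    have num: "a \<otimes> d \<oplus> c \<otimes> b \<in> carrier R" "c \<otimes> f \<oplus> e \<otimes> d \<in> carrier R" using uc vc wc by auto
    have "(a \<otimes> d \<oplus> c \<otimes> b) \<otimes> f \<oplus> e \<otimes> (b \<otimes> d) = a \<otimes> (d \<otimes> f) \<oplus> (c \<otimes> f \<oplus> e \<otimes> d) \<otimes> b"
      "(b \<otimes> d) \<otimes> f = b \<otimes> (d \<otimes> f)" using uc vc wc by algebra+
    then show "(u \<oplus>\<^bsub>fraction_field\<^esub> v) \<oplus>\<^bsub>fraction_field\<^esub> w = u \<oplus>\<^bsub>fraction_field\<^esub> (v \<oplus>\<^bsub>fraction_field\<^esub> w)"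
      unfolding u(1) v(1) w(1) fraction_add[OF u(2,3) v(2,3)] fraction_add[OF v(2,3) w(2,3)]
        fraction_add[OF num(1) bd w(2,3)] fraction_add[OF u(2,3) num(2) df] by simp
  qed
  show "comm_monoid fraction_field"
  proof (rule comm_monoidI)
    show "\<one>\<^bsub>fraction_field\<^esub> \<in> carrier fraction_field" using fraction_closed one_nonzero by simp
    fix u assume "u \<in> carrier fraction_field"
    then obtain a b where u: "u = fraction a b" "a \<in> carrier R" "b \<in> carrier R - {\<zero>}" by (rule fraction_fieldE)
    note uc = u(2) DiffD1[OF u(3)]
    show "\<one>\<^bsub>fraction_field\<^esub> \<otimes>\<^bsub>fraction_field\<^esub> u = u"
      using u one_nonzero by (simp add: fraction_mult)
    fix v assume "v \<in> carrier fraction_field"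
    then obtain c d where v: "v = fraction c d" "c \<in> carrier R" "d \<in> carrier R - {\<zero>}" by (rule fraction_fieldE)
    note vc = v(2) DiffD1[OF v(3)]
    have bd: "b \<otimes> d \<in> carrier R - {\<zero>}" by (rule nonzero_mult[OF u(3) v(3)])
    show "u \<otimes>\<^bsub>fraction_field\<^esub> v \<in> carrier fraction_field"
      unfolding u(1) v(1) fraction_mult[OF u(2,3) v(2,3)] by (rule fraction_closed[OF _ bd]) (use uc vc in simp)
    show "u \<otimes>\<^bsub>fraction_field\<^esub> v = v \<otimes>\<^bsub>fraction_field\<^esub> u"
      unfolding u(1) v(1) fraction_mult[OF u(2,3) v(2,3)] fraction_mult[OF v(2,3) u(2,3)]
      using uc vc by (simp add: m_comm)
    fix w assume "w \<in> carrier fraction_field"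
    then obtain e f where w: "w = fraction e f" "e \<in> carrier R" "f \<in> carrier R - {\<zero>}" by (rule fraction_fieldE)
    note wc = w(2) DiffD1[OF w(3)]
    have df: "d \<otimes> f \<in> carrier R - {\<zero>}" by (rule nonzero_mult[OF v(3) w(3)])
    have num: "a \<otimes> c \<in> carrier R" "c \<otimes> e \<in> carrier R" using uc vc wc by auto
    show "(u \<otimes>\<^bsub>fraction_field\<^esub> v) \<otimes>\<^bsub>fraction_field\<^esub> w = u \<otimes>\<^bsub>fraction_field\<^esub> (v \<otimes>\<^bsub>fraction_field\<^esub> w)"
      unfolding u(1) v(1) w(1) fraction_mult[OF u(2,3) v(2,3)] fraction_mult[OF v(2,3) w(2,3)]
        fraction_mult[OF num(1) bd w(2,3)] fraction_mult[OF u(2,3) num(2) df]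
      using uc vc wc by (simp add: m_assoc)
  qed
  fix u v w assume "u \<in> carrier fraction_field" "v \<in> carrier fraction_field" "w \<in> carrier fraction_field"
  note uvw = this
  obtain a b where u: "u = fraction a b" "a \<in> carrier R" "b \<in> carrier R - {\<zero>}"
    using uvw(1) by (rule fraction_fieldE)
  obtain c d where v: "v = fraction c d" "c \<in> carrier R" "d \<in> carrier R - {\<zero>}"
    using uvw(2) by (rule fraction_fieldE)
  obtain e f where w: "w = fraction e f" "e \<in> carrier R" "f \<in> carrier R - {\<zero>}"
    using uvw(3) by (rule fraction_fieldE)
  note c = u(2) DiffD1[OF u(3)] v(2) DiffD1[OF v(3)] w(2) DiffD1[OF w(3)]
  note d = nonzero_mult[OF u(3) v(3)] nonzero_mult[OF u(3) w(3)] nonzero_mult[OF v(3) w(3)]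
  have num: "a \<otimes> d \<oplus> c \<otimes> b \<in> carrier R" "a \<otimes> e \<in> carrier R" "c \<otimes> e \<in> carrier R" using c by auto
  have num2: "(a \<otimes> d \<oplus> c \<otimes> b) \<otimes> e \<in> carrier R"
    "(a \<otimes> e) \<otimes> (d \<otimes> f) \<oplus> (c \<otimes> e) \<otimes> (b \<otimes> f) \<in> carrier R" using c by auto
  have "((a \<otimes> d \<oplus> c \<otimes> b) \<otimes> e) \<otimes> ((b \<otimes> f) \<otimes> (d \<otimes> f)) =
    ((a \<otimes> e) \<otimes> (d \<otimes> f) \<oplus> (c \<otimes> e) \<otimes> (b \<otimes> f)) \<otimes> ((b \<otimes> d) \<otimes> f)"
    using c by algebra
  then show "(u \<oplus>\<^bsub>fraction_field\<^esub> v) \<otimes>\<^bsub>fraction_field\<^esub> w =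
    u \<otimes>\<^bsub>fraction_field\<^esub> w \<oplus>\<^bsub>fraction_field\<^esub> v \<otimes>\<^bsub>fraction_field\<^esub> w"
    unfolding u(1) v(1) w(1) fraction_add[OF u(2,3) v(2,3)] fraction_mult[OF num(1) d(1) w(2,3)]
      fraction_mult[OF u(2,3) w(2,3)] fraction_mult[OF v(2,3) w(2,3)] fraction_add[OF num(2) d(2) num(3) d(3)]
    using fraction_eq_iff[OF num2(1) nonzero_mult[OF d(1) w(3)] num2(2) nonzero_mult[OF d(2,3)]] by simp
qed

lemma fraction_field_field: "field fraction_field"
proof (rule cring.cring_fieldI2[OF fraction_field_cring])
  show "\<zero>\<^bsub>fraction_field\<^esub> \<noteq> \<one>\<^bsub>fraction_field\<^esub>"
    unfolding fraction_one fraction_zero using fraction_eq_iff[of \<zero> \<one> \<one> \<one>] by simp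
  fix u assume u: "u \<in> carrier fraction_field" "u \<noteq> \<zero>\<^bsub>fraction_field\<^esub>"
  obtain a b where ab: "u = fraction a b" "a \<in> carrier R" "b \<in> carrier R - {\<zero>}"
    using u(1) by (rule fraction_fieldE)
  have "a \<noteq> \<zero>"
    using u(2) ab fraction_eq_iff[OF ab(2,3), of \<zero> \<one>] unfolding fraction_zero by auto
  then have a: "a \<in> carrier R - {\<zero>}" using ab by simp
  have "u \<otimes>\<^bsub>fraction_field\<^esub> fraction b a = fraction (a \<otimes> b) (b \<otimes> a)"
    unfolding ab(1) by (rule fraction_mult) (use ab a in auto)
  also have "\<dots> = \<one>\<^bsub>fraction_field\<^esub>"
    unfolding fraction_one using fraction_eq_iff[of "a \<otimes> b" "b \<otimes> a" \<one> \<one>] nonzero_mult[OF ab(3) a] ab a by (simp add: m_comm)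
  finally show "\<exists>v\<in>carrier fraction_field. u \<otimes>\<^bsub>fraction_field\<^esub> v = \<one>\<^bsub>fraction_field\<^esub>"
    using fraction_closed[of b a] a ab by blast
qed

lemma fraction_hom: "(\<lambda>a. fraction a \<one>) \<in> ring_hom R fraction_field"
proof (rule ring_hom_memI)
  fix x y assume "x \<in> carrier R" "y \<in> carrier R"
  then show "fraction (x \<otimes> y) \<one> = fraction x \<one> \<otimes>\<^bsub>fraction_field\<^esub> fraction y \<one>"
    "fraction (x \<oplus> y) \<one> = fraction x \<one> \<oplus>\<^bsub>fraction_field\<^esub> fraction y \<one>"
    by (simp_all add: fraction_mult fraction_add)
qed (simp_all add: fraction_closed fraction_one)

lemma fraction_inj: "inj_on (\<lambda>a. fraction a \<one>) (carrier R)"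
  by (rule inj_onI) (use fraction_eq_iff in simp)

end

section \<open>Submaximality\<close>

text \<open>A subring \<open>N\<close> is chosen maximal among those containing \<open>S\<close> and
  avoiding \<open>q\<close>. Any larger subring contains \<open>q\<close>, hence each
  \<open>x = q ^ n (p ^ n x)\<close>, since \<open>p ^ n x\<close> is in \<open>S\<close> for a
  suitable \<open>n\<close>.\<close>

lemma (in cring) submaximal_of_power_cover:
  assumes S: "subring S R" "p \<in> S" and q: "q \<in> carrier R" "q \<notin> S" "p \<otimes> q = \<one>"
    and cover: "\<And>x. x \<in> carrier R \<Longrightarrow> \<exists>n::nat. p [^] n \<otimes> x \<in> S"
  shows "submaximal R"
proof -
  let ?A = "{S'. subring S' R \<and> S \<subseteq> S' \<and> q \<notin> S'}"
  have "\<exists>S'\<in>?A. \<forall>T\<in>?A. S' \<subseteq> T \<longrightarrow> T = S'"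
  proof (rule subset_Zorn_nonempty)
    show "?A \<noteq> {}" using S q by auto
    fix C assume C: "C \<noteq> {}" "subset.chain ?A C"
    have CA: "S \<subseteq> S' \<and> q \<notin> S'" if "S' \<in> C" for S'
      using C(2) that unfolding pred_on.chain_def by auto
    have "subring (\<Union>C) R" by (rule chain_Union_subring[OF C]) simp
    moreover obtain S' where "S' \<in> C" using C(1) by auto
    ultimately show "\<Union>C \<in> ?A" using CA by auto
  qed
  then obtain N where N: "N \<in> ?A" and max: "\<forall>T\<in>?A. N \<subseteq> T \<longrightarrow> T = N" ..
  have "maximal_subring N R" unfolding maximal_subring_def
  proof (intro conjI notI)
    show "subring N R" using N by simp
    show "N \<subset> carrier R" using N q(1) subringE(1)[of N R] by auto
    assume "\<exists>T. subring T R \<and> N \<subset> T \<and> T \<subset> carrier R"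
    then obtain T where T: "subring T R" "N \<subset> T" "T \<subset> carrier R" by auto
    then have qT: "q \<in> T" using max N by auto
    have pc: "p \<in> carrier R" using S subringE(1) by auto
    have qn: "q [^] (n::nat) \<in> T" for n
    proof (induction n)
      case (Suc n)
      then show ?case using subringE(6)[OF T(1) Suc qT] by simp
    qed (simp add: subringE(3)[OF T(1)])
    have "x \<in> T" if x: "x \<in> carrier R" for x
    proof -
      obtain n :: nat where n: "p [^] n \<otimes> x \<in> S" using cover[OF x] by auto
      have "q [^] n \<otimes> (p [^] n \<otimes> x) = (p \<otimes> q) [^] n \<otimes> x"
        using x pc q(1) by (simp add: nat_pow_distrib m_ac)
      then have "x = q [^] n \<otimes> (p [^] n \<otimes> x)" using q(3) x by simp
      also have "\<dots> \<in> T" using subringE(6)[OF T(1) qn] n N T(2) by auto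
      finally show ?thesis .
    qed
    then show False using T(3) by auto
  qed
  then show ?thesis unfolding submaximal_def by auto
qed

text \<open>Injectivity carries over the two negative clauses, that \<open>0\<close> is not in
  \<open>W\<close> and that \<open>W\<close> avoids \<open>pA\<close>; the others hold under any
  homomorphism.\<close>

lemma (in ring_hom_ring) denominators_image:
  assumes inj: "inj_on h (carrier R)" and den: "R.denominators A p W"
  shows "S.denominators (h ` A) (h p) (h ` W)"
proof -
  have A: "subring A R" and pA: "p \<in> A" and WA: "W \<subseteq> A" and W1: "\<one> \<in> W" and W0: "\<zero> \<notin> W"
    and Wm: "\<And>v w. v \<in> W \<Longrightarrow> w \<in> W \<Longrightarrow> v \<otimes> w \<in> W" and Wp: "\<And>w a. w \<in> W \<Longrightarrow> a \<in> A \<Longrightarrow> w \<noteq> p \<otimes> a"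
    and Wa: "\<And>a. a \<in> A \<Longrightarrow> a \<noteq> \<zero> \<Longrightarrow> \<exists>b\<in>A. \<exists>w\<in>W. \<exists>n::nat. a \<otimes> b = p [^] n \<otimes> w"
    using den unfolding R.denominators_def by auto
  have Ac: "a \<in> carrier R" if "a \<in> A" for a using subringE(1)[OF A] that by auto
  have Wc: "w \<in> carrier R" if "w \<in> W" for w using WA Ac that by auto
  have eq: "x = y" if "h x = h y" "x \<in> carrier R" "y \<in> carrier R" for x y
    using inj that by (auto dest: inj_onD)
  show ?thesis unfolding S.denominators_def
  proof (intro conjI ballI)
    show "subring (h ` A) S" by (rule img_is_subring[OF A])
    show "h p \<in> h ` A" "h ` W \<subseteq> h ` A" using pA WA by auto
    show "\<one>\<^bsub>S\<^esub> \<in> h ` W" using W1 hom_one by (metis imageI)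
    show "\<zero>\<^bsub>S\<^esub> \<notin> h ` W"
    proof
      assume "\<zero>\<^bsub>S\<^esub> \<in> h ` W"
      then obtain w where w: "w \<in> W" "h w = h \<zero>" by auto
      from eq[OF w(2) Wc[OF w(1)]] show False using W0 w(1) by simp
    qed
    fix v assume "v \<in> h ` W"
    then obtain v' where v: "v = h v'" "v' \<in> W" by auto
    show "v \<otimes>\<^bsub>S\<^esub> w \<in> h ` W" if "w \<in> h ` W" for w
    proof -
      from that obtain w' where w: "w = h w'" "w' \<in> W" by auto
      have "v \<otimes>\<^bsub>S\<^esub> w = h (v' \<otimes> w')" unfolding v(1) w(1) using v w Wc by simp
      then show ?thesis using Wm[OF v(2) w(2)] by simp
    qed
    show "v \<noteq> h p \<otimes>\<^bsub>S\<^esub> a" if "a \<in> h ` A" for a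
    proof
      assume va: "v = h p \<otimes>\<^bsub>S\<^esub> a"
      from that obtain a' where a: "a = h a'" "a' \<in> A" by auto
      have "h v' = h (p \<otimes> a')" using va v(1) a Ac pA by simp
      from eq[OF this Wc[OF v(2)]] show False using Wp[OF v(2) a(2)] Ac pA a(2) by simp
    qed
  next
    fix a assume a: "a \<in> h ` A - {\<zero>\<^bsub>S\<^esub>}"
    then obtain a' where a': "a = h a'" "a' \<in> A" by auto
    then have "a' \<noteq> \<zero>" using a by auto
    from Wa[OF a'(2) this] obtain b w and n :: nat where b: "b \<in> A" "w \<in> W" "a' \<otimes> b = p [^] n \<otimes> w" by auto
    have "a \<otimes>\<^bsub>S\<^esub> h b = h (a' \<otimes> b)" using a' b(1) Ac by simp
    also have "\<dots> = h p [^]\<^bsub>S\<^esub> n \<otimes>\<^bsub>S\<^esub> h w"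
      unfolding b(3) using Ac[OF pA] Wc[OF b(2)] by (simp add: hom_nat_pow)
    finally show "\<exists>b\<in>h ` A. \<exists>w\<in>h ` W. \<exists>n::nat. a \<otimes>\<^bsub>S\<^esub> b = h p [^]\<^bsub>S\<^esub> n \<otimes>\<^bsub>S\<^esub> w"
      using b by auto
  qed
qed

text \<open>The data are transported to the fraction field, extended there to a ring
  \<open>S\<close>, and \<open>S\<close> is pulled back to \<open>R\<close>. The preimage misses
  \<open>q\<close> because \<open>h q\<close> is the inverse of \<open>h p\<close>.\<close>

lemma (in domain) submaximal_of_denominators:
  assumes den: "denominators A p W" and q: "q \<in> carrier R" "p \<otimes> q = \<one>"
  shows "submaximal R"
proof -
  define h where "h = (\<lambda>a. fraction a \<one>)"
  define L where "L = fraction_field"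
  interpret L: field L unfolding L_def by (rule fraction_field_field)
  have hom: "h \<in> ring_hom R L" unfolding h_def L_def by (rule fraction_hom)
  interpret h: ring_hom_ring R L h
    by (rule ring_hom_ringI2[OF ring_axioms L.ring_axioms hom])
  have inj: "inj_on h (carrier R)" unfolding h_def by (rule fraction_inj)
  have A: "subring A R" "p \<in> A" using den unfolding denominators_def by auto
  have pc: "p \<in> carrier R" using A subringE(1) by auto
  have hpq: "h p \<otimes>\<^bsub>L\<^esub> h q = \<one>\<^bsub>L\<^esub>" using q pc h.hom_mult[OF pc q(1)] by simp
  have pnz: "h p \<noteq> \<zero>\<^bsub>L\<^esub>"
    using hpq L.l_null[OF h.hom_closed[OF q(1)]] by auto
  interpret L: pointed_field L "h p"
    by (intro pointed_field.intro pointed_field_axioms.intro L.field_axioms h.hom_closed[OF pc] pnz)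
  obtain S where S: "subring S L" "h ` A \<subseteq> S" "inv\<^bsub>L\<^esub> (h p) \<notin> S"
    and cover: "\<And>x. x \<in> carrier L \<Longrightarrow> \<exists>n::nat. h p [^]\<^bsub>L\<^esub> n \<otimes>\<^bsub>L\<^esub> x \<in> S"
    using L.rank_one_extension[OF h.denominators_image[OF inj den]] by blast
  have inv: "inv\<^bsub>L\<^esub> (h p) = h q"
    by (rule L.inv_uniq[OF h.hom_closed[OF pc] h.hom_closed[OF q(1)] hpq])
  show ?thesis
  proof (rule submaximal_of_power_cover)
    let ?S = "{x \<in> carrier R. h x \<in> S}"
    note SE = subringE[OF S(1)]
    show "subring ?S R"
    proof (rule subringI)
      show "\<one> \<in> ?S" using SE(3) by simp
      show "\<ominus> x \<in> ?S" if "x \<in> ?S" for x using that SE(5) by simp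
      show "x \<otimes> y \<in> ?S" if "x \<in> ?S" "y \<in> ?S" for x y using that SE(6) by simp
      show "x \<oplus> y \<in> ?S" if "x \<in> ?S" "y \<in> ?S" for x y using that SE(7) by simp
    qed auto
    show "p \<in> ?S" using A S(2) pc by auto
    show "q \<in> carrier R" "p \<otimes> q = \<one>" by (fact q)+
    show "q \<notin> ?S" using S(3) inv by simp
    show "\<exists>n::nat. p [^] n \<otimes> x \<in> ?S" if x: "x \<in> carrier R" for x
      using cover[OF h.hom_closed[OF x]] x pc by (simp add: h.hom_nat_pow)
  qed
qed

text \<open>With \<open>K\<close> the fraction field of \<open>D\<close>, localising
  \<open>D[u]\<close> at the expressions with nonzero constant term gives \<open>K[u]\<close>
  localised at \<open>u\<close>, the ring of the \<open>u\<close>-adic valuation. Transcendence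
  makes constant terms well defined.\<close>

lemma (in domain) submaximal_of_transcendental_unit:
  assumes D: "subring D R" and u: "u \<in> carrier R" "v \<in> carrier R" "u \<otimes> v = \<one>"
    and trans: "(transcendental over D) u"
  shows "submaximal R"
proof -
  define A where "A = simple_extension D u"
  define W where "W = {f \<otimes> u \<oplus> a | f a. f \<in> A \<and> a \<in> D \<and> a \<noteq> \<zero>}"
  note DE = subringE[OF D]
  have A: "subring A R" unfolding A_def by (rule simple_extension_is_subring[OF D u(1)])
  note AE = subringE[OF A]
  have Ac: "a \<in> carrier R" if "a \<in> A" for a using AE(1) that by auto
  have Dc: "a \<in> carrier R" if "a \<in> D" for a using DE(1) that by auto
  have DA: "D \<subseteq> A" unfolding A_def by (rule simple_extension_incl[OF DE(1) u(1)])
  have uA: "u \<in> A" unfolding A_def by (rule simple_extension_mem[OF D u(1)])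
  have rel: "a = \<zero>" if "f \<in> A" "a \<in> D" "f \<otimes> u \<oplus> a = \<zero>" for f a
    using algebraic_if_relation[OF D u(1), of f a] that trans unfolding A_def over_def by auto
  have Wp: "w \<noteq> u \<otimes> b" if "w \<in> W" "b \<in> A" for w b
  proof
    assume eq: "w = u \<otimes> b"
    from that obtain f a where w: "w = f \<otimes> u \<oplus> a" "f \<in> A" "a \<in> D" "a \<noteq> \<zero>" unfolding W_def by auto
    note c = Ac[OF w(2)] Dc[OF w(3)] Ac[OF that(2)]
    have "(f \<oplus> \<ominus> b) \<otimes> u \<oplus> a = (f \<otimes> u \<oplus> a) \<oplus> \<ominus> (u \<otimes> b)" using c u(1) by algebra
    also have "\<dots> = \<zero>" unfolding w(1)[symmetric] eq using c u(1) by algebra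
    finally show False using rel[OF AE(7)[OF w(2) AE(5)[OF that(2)]] w(3)] w(4) by simp
  qed
  have W1: "\<one> \<in> W"
  proof -
    have "\<one> = \<zero> \<otimes> u \<oplus> \<one>" using u(1) by simp
    then show ?thesis unfolding W_def using AE(2) DE(3) one_not_zero by blast
  qed
  have "denominators A u W" unfolding denominators_def
  proof (intro conjI ballI)
    show "subring A R" "u \<in> A" "\<one> \<in> W" by (fact A uA W1)+
    show "W \<subseteq> A" unfolding W_def using AE(6,7) uA DA by auto
    show "w \<noteq> u \<otimes> b" if "w \<in> W" "b \<in> A" for w b by (rule Wp[OF that])
    show "\<zero> \<notin> W" using Wp[OF _ AE(2)] u(1) by auto
    show "v \<otimes> w \<in> W" if vw: "v \<in> W" "w \<in> W" for v w
    proof -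
      from vw obtain f a g b where v: "v = f \<otimes> u \<oplus> a" "f \<in> A" "a \<in> D" "a \<noteq> \<zero>"
        and w: "w = g \<otimes> u \<oplus> b" "g \<in> A" "b \<in> D" "b \<noteq> \<zero>" unfolding W_def by auto
      have "v \<otimes> w = ((f \<otimes> g) \<otimes> u \<oplus> (b \<otimes> f \<oplus> a \<otimes> g)) \<otimes> u \<oplus> a \<otimes> b"
        unfolding v(1) w(1) using Ac[OF v(2)] Ac[OF w(2)] Dc[OF v(3)] Dc[OF w(3)] u(1) by algebra
      moreover have "(f \<otimes> g) \<otimes> u \<oplus> (b \<otimes> f \<oplus> a \<otimes> g) \<in> A"
        using v w DA uA by (intro AE(6,7)) auto
      moreover have "a \<otimes> b \<noteq> \<zero>" using integral_iff v w Dc by simp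
      ultimately show ?thesis unfolding W_def using DE(6)[OF v(3) w(3)] by blast
    qed
    \<comment> \<open>Splitting off factors \<open>u\<close> as long as the constant term vanishes
      leaves an element of \<open>W\<close>; hence \<open>b = 1\<close> serves as the witness
      afterwards.\<close>
    have "h = \<zero> \<or> (\<exists>w\<in>W. \<exists>n::nat. h = u [^] n \<otimes> w)" if "h \<in> A" for h
      using that unfolding A_def
    proof (induction rule: simple_extension.induct)
      case (lin k1 k2)
      then have k1: "k1 \<in> A" unfolding A_def by simp
      note c = Ac[OF k1] Dc[OF lin(2)]
      show ?case
      proof (cases "k2 = \<zero>")
        case False
        then have w: "k1 \<otimes> u \<oplus> k2 \<in> W" unfolding W_def using k1 lin(2) by blast
        moreover have "k1 \<otimes> u \<oplus> k2 = u [^] (0::nat) \<otimes> (k1 \<otimes> u \<oplus> k2)" using c u(1) by simp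
        ultimately show ?thesis by blast
      next
        case True
        show ?thesis
        proof (cases "k1 = \<zero>")
          case False
          with lin(3) obtain w and n :: nat where w: "w \<in> W" "k1 = u [^] n \<otimes> w" by auto
          have wc: "w \<in> carrier R" using w(1) Ac Dc u(1) unfolding W_def by auto
          have "k1 \<otimes> u \<oplus> k2 = u [^] (Suc n) \<otimes> w"
            unfolding w(2) True using wc u(1) by (simp add: m_ac)
          then show ?thesis using w(1) by blast
        qed (use True u(1) in simp)
      qed
    qed simp
    then show "\<exists>b\<in>A. \<exists>w\<in>W. \<exists>n::nat. a \<otimes> b = u [^] n \<otimes> w" if a: "a \<in> A - {\<zero>}" for a
      using a AE(3) Ac r_one by (metis DiffD1 DiffD2 singletonI)
  qed
  from submaximal_of_denominators[OF this u(2,3)] show ?thesis .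
qed

text \<open>\<open>W\<close> is the complement of the prime ideal generated by \<open>p\<close>, so
  the localisation is the \<open>p\<close>-adic valuation ring. Principality enters in the last
  clause, through a generator of the ideal \<open>I\<close>.\<close>

lemma (in principal_domain) prime_denominators:
  assumes p: "p \<in> carrier R" "ring_prime p"
  shows "denominators (carrier R) p {w \<in> carrier R. \<not> p divides w}"
proof -
  have p0: "p \<noteq> \<zero>" and pr: "prime R p" using ring_primeE[OF p] by auto
  have pU: "\<not> p divides \<one>"
    using pr divides_one[OF p(1)] unfolding prime_def by simp
  have pdvd: "p divides a \<or> p divides b" if "a \<in> carrier R" "b \<in> carrier R" "p divides (a \<otimes> b)" for a b
    using pr that unfolding prime_def by auto
  show ?thesis unfolding denominators_def
  proof (intro conjI ballI)
    show "subring (carrier R) R" by (rule carrier_is_subring)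
    show "p \<in> carrier R" by fact
    show "{w \<in> carrier R. \<not> p divides w} \<subseteq> carrier R" by auto
    show "\<one> \<in> {w \<in> carrier R. \<not> p divides w}" using pU by simp
    have "p divides \<zero>" by (rule divides_zero[OF p(1)])
    then show "\<zero> \<notin> {w \<in> carrier R. \<not> p divides w}" by simp
    show "v \<otimes> w \<in> {w \<in> carrier R. \<not> p divides w}"
      if "v \<in> {w \<in> carrier R. \<not> p divides w}" "w \<in> {w \<in> carrier R. \<not> p divides w}" for v w
      using that pdvd by auto
    show "w \<noteq> p \<otimes> a" if "w \<in> {w \<in> carrier R. \<not> p divides w}" "a \<in> carrier R" for w a
      using that unfolding factor_def by auto
    fix a assume a: "a \<in> carrier R - {\<zero>}"
    \<comment> \<open>Passing to a generator of \<open>I\<close> avoids \<open>p\<close>-adic multiplicities.\<close>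
    define I where "I = {d \<in> carrier R. \<exists>b\<in>carrier R. \<exists>n::nat. a \<otimes> b = p [^] n \<otimes> d}"
    have "ideal I R"
    proof (rule idealI[OF ring_axioms])
      have mult: "x \<otimes> d \<in> I" if d: "d \<in> I" and x: "x \<in> carrier R" for x d
      proof -
        from d obtain b and n :: nat where b: "d \<in> carrier R" "b \<in> carrier R" "a \<otimes> b = p [^] n \<otimes> d"
          unfolding I_def by auto
        have ac: "a \<in> carrier R" using a by simp
        have "a \<otimes> (x \<otimes> b) = x \<otimes> (a \<otimes> b)" by (rule m_lcomm[OF ac x b(2)])
        also have "\<dots> = p [^] n \<otimes> (x \<otimes> d)" unfolding b(3) using b x p(1) by (simp add: m_lcomm)
        finally show ?thesis unfolding I_def using b x by blast
      qed
      then show "x \<otimes> d \<in> I" if "d \<in> I" "x \<in> carrier R" for x d using that .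
      show "d \<otimes> x \<in> I" if d: "d \<in> I" "x \<in> carrier R" for x d
        using mult[OF d] d m_comm unfolding I_def by simp
      show "subgroup I (add_monoid R)"
      proof (rule add.subgroupI)
        show "I \<subseteq> carrier R" unfolding I_def by auto
        have "a \<otimes> \<one> = p [^] (0::nat) \<otimes> a" using a by simp
        then have "a \<in> I" unfolding I_def using a by blast
        then show "I \<noteq> {}" by auto
        fix d assume d: "d \<in> I"
        then have dc: "d \<in> carrier R" unfolding I_def by auto
        have "(\<ominus> \<one>) \<otimes> d = \<ominus> d" using dc l_minus by simp
        then show "\<ominus> d \<in> I" using mult[OF d, of "\<ominus> \<one>"] by simp
        fix e assume e: "e \<in> I"
        from d obtain b and n :: nat where b: "d \<in> carrier R" "b \<in> carrier R" "a \<otimes> b = p [^] n \<otimes> d"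
          unfolding I_def by auto
        from e obtain c and m :: nat where c: "e \<in> carrier R" "c \<in> carrier R" "a \<otimes> c = p [^] m \<otimes> e"
          unfolding I_def by auto
        have pc: "p [^] n \<in> carrier R" "p [^] m \<in> carrier R" "a \<in> carrier R" using p(1) a by auto
        have "a \<otimes> (p [^] m \<otimes> b \<oplus> p [^] n \<otimes> c) = p [^] m \<otimes> (a \<otimes> b) \<oplus> p [^] n \<otimes> (a \<otimes> c)"
          using b(1,2) c(1,2) pc by algebra
        also have "\<dots> = (p [^] n \<otimes> p [^] m) \<otimes> (d \<oplus> e)"
          unfolding b(3) c(3) using b(1,2) c(1,2) pc by algebra
        also have "\<dots> = p [^] (n + m) \<otimes> (d \<oplus> e)" using p(1) by (simp add: nat_pow_mult)
        finally show "d \<oplus> e \<in> I"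
          unfolding I_def using b(1,2) c(1,2) pc by blast
      qed
    qed
    then obtain w where w: "w \<in> carrier R" "I = PIdl w" using exists_gen by blast
    have wI: "w \<in> I" unfolding w(2) by (rule cgenideal_self[OF w(1)])
    then obtain b and n :: nat where b: "b \<in> carrier R" "a \<otimes> b = p [^] n \<otimes> w" unfolding I_def by auto
    have "a \<otimes> \<one> = p [^] (0::nat) \<otimes> a" using a by simp
    then have "a \<in> I" unfolding I_def using a by blast
    then have w0: "w \<noteq> \<zero>" using a w unfolding cgenideal_def by auto
    \<comment> \<open>If \<open>p\<close> divided the generator, then \<open>w/p\<close> would lie
      in \<open>I\<close> too, with exponent \<open>n + 1\<close>. It would be a multiple of
      \<open>w\<close>, making \<open>p\<close> a unit.\<close>
    have "\<not> p divides w"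
    proof
      assume "p divides w"
      then obtain w' where w': "w' \<in> carrier R" "w = p \<otimes> w'" unfolding factor_def by auto
      have "a \<otimes> b = p [^] (Suc n) \<otimes> w'" unfolding b(2) w'(2) using w' p(1) by (simp add: m_assoc)
      then have "w' \<in> I" unfolding I_def using w'(1) b(1) by blast
      then obtain t where t: "t \<in> carrier R" "w' = t \<otimes> w" unfolding w(2) cgenideal_def by auto
      have "w \<otimes> (p \<otimes> t) = p \<otimes> (t \<otimes> w)" using w(1) p(1) t(1) by algebra
      also have "\<dots> = w \<otimes> \<one>" using w'(2) t(2) w(1) by simp
      finally have "p \<otimes> t = \<one>" using m_lcancel[OF w0 w(1), of "p \<otimes> t" \<one>] p(1) t(1) by simp
      then have "p divides \<one>" using dividesI[OF t(1), of \<one> p] by simp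
      then show False using pU by simp
    qed
    then show "\<exists>b\<in>carrier R. \<exists>w\<in>{w \<in> carrier R. \<not> p divides w}. \<exists>n::nat. a \<otimes> b = p [^] n \<otimes> w"
      using b w(1) by blast
  qed
qed

text \<open>All clauses speak about elements of \<open>D\<close> and the inherited operations, so
  the ambient ring can be enlarged; only powers have to be converted.\<close>

lemma (in ring) denominators_subring:
  assumes D: "subring D R" and den: "ring.denominators (R\<lparr>carrier := D\<rparr>) D p W"
  shows "denominators D p W"
  using den D unfolding denominators_def ring.denominators_def[OF subring_is_ring[OF D]]
  by (simp add: nat_pow_consistent[symmetric])

text \<open>\<open>g\<close> generates the ideal of \<open>c\<close> and \<open>d\<close>, so it is
  a greatest common divisor. Cancelling it from \<open>g = x d + y c\<close> gives the Bezout
  identity.\<close>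

lemma (in principal_domain) coprime_quotients:
  assumes c: "c \<in> carrier R" "c \<noteq> \<zero>" and d: "d \<in> carrier R"
  obtains g c' d' x y where "g \<in> carrier R" "c' \<in> carrier R" "d' \<in> carrier R" "x \<in> carrier R" "y \<in> carrier R"
    "g \<noteq> \<zero>" "c = g \<otimes> c'" "d = g \<otimes> d'" "x \<otimes> d' \<oplus> y \<otimes> c' = \<one>"
proof -
  have "ideal (PIdl d <+>\<^bsub>R\<^esub> PIdl c) R" by (intro add_ideals cgenideal_ideal c d)
  then obtain g where g: "g \<in> carrier R" "PIdl d <+>\<^bsub>R\<^esub> PIdl c = PIdl g" using exists_gen by blast
  have "\<zero> \<otimes> d \<oplus> \<one> \<otimes> c \<in> PIdl d <+>\<^bsub>R\<^esub> PIdl c" "\<one> \<otimes> d \<oplus> \<zero> \<otimes> c \<in> PIdl d <+>\<^bsub>R\<^esub> PIdl c"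
    unfolding set_add_def' cgenideal_def by blast+
  then have "c \<in> PIdl g" "d \<in> PIdl g" using c d g(2) by auto
  then obtain c' d' where cd: "c' \<in> carrier R" "c = c' \<otimes> g" "d' \<in> carrier R" "d = d' \<otimes> g"
    unfolding cgenideal_def by auto
  have "g \<in> PIdl d <+>\<^bsub>R\<^esub> PIdl c" unfolding g(2) by (rule cgenideal_self[OF g(1)])
  then obtain x y where xy: "x \<in> carrier R" "y \<in> carrier R" "g = x \<otimes> d \<oplus> y \<otimes> c"
    unfolding set_add_def' cgenideal_def by auto
  have g0: "g \<noteq> \<zero>" using c cd by auto
  have "g \<otimes> (x \<otimes> d' \<oplus> y \<otimes> c') = x \<otimes> (d' \<otimes> g) \<oplus> y \<otimes> (c' \<otimes> g)" using g(1) cd(1,3) xy(1,2) by algebra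
  also have "\<dots> = g \<otimes> \<one>" using xy(3) cd(2,4) g(1) by simp
  finally have bez: "x \<otimes> d' \<oplus> y \<otimes> c' = \<one>"
    using m_lcancel[OF g0 g(1), of "x \<otimes> d' \<oplus> y \<otimes> c'" \<one>] cd(1,3) xy(1,2) by simp
  show thesis
    by (rule that[OF g(1) cd(1,3) xy(1,2) g0 _ _ bez]) (use cd g(1) m_comm in auto)
qed

section \<open>Clearing the leading coefficient of an algebraic relation\<close>

fun (in ring) scale_coeffs :: "'a \<Rightarrow> nat \<Rightarrow> 'a list \<Rightarrow> 'a list" where
  "scale_coeffs c k [] = []"
| "scale_coeffs c k (a # qs) = c [^] k \<otimes> a # scale_coeffs c (Suc k) qs"

text \<open>The scaling compensates for the powers of \<open>c\<close> in \<open>c x\<close>: every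
  term acquires the same total power of \<open>c\<close>. The extra factor \<open>c\<close> on the
  left avoids the exponent \<open>length qs - 1\<close>.\<close>

lemma (in cring) eval_scale_coeffs:
  assumes c: "c \<in> carrier R" and x: "x \<in> carrier R"
  shows "set qs \<subseteq> carrier R \<Longrightarrow> c \<otimes> eval (scale_coeffs c k qs) (c \<otimes> x) = c [^] (k + length qs) \<otimes> eval qs x"
    and "length (scale_coeffs c k qs) = length qs"
    and "set qs \<subseteq> carrier R \<Longrightarrow> set (scale_coeffs c k qs) \<subseteq> carrier R"
proof -
  show len: "length (scale_coeffs c k qs) = length qs" for k
    by (induction qs arbitrary: k) auto
  show sub: "set qs \<subseteq> carrier R \<Longrightarrow> set (scale_coeffs c k qs) \<subseteq> carrier R" for k
    using c by (induction qs arbitrary: k) auto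
  show "set qs \<subseteq> carrier R \<Longrightarrow> c \<otimes> eval (scale_coeffs c k qs) (c \<otimes> x) = c [^] (k + length qs) \<otimes> eval qs x"
  proof (induction qs arbitrary: k)
    case Nil
    then show ?case using c by simp
  next
    case (Cons a qs)
    have l: "length (scale_coeffs c j qs) = length qs" for j
      by (induction qs arbitrary: j) auto
    have s: "set (scale_coeffs c (Suc k) qs) \<subseteq> carrier R"
      using Cons.prems c by (induction qs arbitrary: k) auto
    let ?n = "length qs" and ?E = "eval (scale_coeffs c (Suc k) qs) (c \<otimes> x)"
    have cl: "a \<in> carrier R" "?E \<in> carrier R" "eval qs x \<in> carrier R" "x [^] ?n \<in> carrier R"
      "c [^] ?n \<in> carrier R" "c [^] k \<in> carrier R"
      using Cons.prems eval_in_carrier[OF s] eval_in_carrier[of qs x] c x by auto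
    have IH: "c \<otimes> ?E = c [^] (Suc k + ?n) \<otimes> eval qs x" using Cons.IH[of "Suc k"] Cons.prems by simp
    have pw: "c [^] (Suc k + ?n) = c \<otimes> c [^] k \<otimes> c [^] ?n"
      using c by (simp add: nat_pow_mult[symmetric] m_ac)
    have "c \<otimes> eval (scale_coeffs c k (a # qs)) (c \<otimes> x) = c \<otimes> ((c [^] k \<otimes> a) \<otimes> (c [^] ?n \<otimes> x [^] ?n) \<oplus> ?E)"
      using c x by (simp add: l nat_pow_distrib)
    also have "\<dots> = (c \<otimes> c [^] k \<otimes> c [^] ?n) \<otimes> (a \<otimes> x [^] ?n) \<oplus> c \<otimes> ?E" using cl c by algebra
    also have "\<dots> = c [^] (Suc k + ?n) \<otimes> (a \<otimes> x [^] ?n) \<oplus> c [^] (Suc k + ?n) \<otimes> eval qs x"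
      unfolding IH pw ..
    also have "\<dots> = c [^] (Suc k + ?n) \<otimes> (a \<otimes> x [^] ?n \<oplus> eval qs x)"
      using cl c nat_pow_closed[OF c, of "Suc k + ?n"] by algebra
    finally show ?case by simp
  qed
qed

text \<open>Multiplying a relation of degree \<open>n\<close> by \<open>c ^ (n - 1)\<close> and
  regrouping in powers of \<open>c x\<close> gives a monic relation with coefficients in
  \<open>D\<close>.\<close>

lemma (in domain) integral_lead_coeff_mult:
  assumes D: "subring D R" and x: "x \<in> carrier R" and p: "polynomial D (c # qs)" and root: "eval (c # qs) x = \<zero>"
  shows "integral_over R D (c \<otimes> x)"
proof -
  note DE = subringE[OF D]
  have c: "c \<in> D" "c \<in> carrier R" "c \<noteq> \<zero>" and asD: "set qs \<subseteq> D" using p DE(1) unfolding polynomial_def by auto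
  have asc: "set qs \<subseteq> carrier R" using asD DE(1) by auto
  have cD: "c [^] (k::nat) \<in> D" for k
  proof (induction k)
    case (Suc k)
    then show ?case using DE(6)[OF Suc c(1)] by simp
  qed (simp add: DE(3))
  let ?q = "scale_coeffs c 0 qs"
  have "set (scale_coeffs c k bs) \<subseteq> D" if "set bs \<subseteq> D" for k bs
    using that by (induction bs arbitrary: k) (auto intro: DE(6) cD)
  from this[OF asD] have q: "set ?q \<subseteq> D" .
  note sc = eval_scale_coeffs[OF c(2) x, where qs = qs and k = 0]
  have qc: "eval ?q (c \<otimes> x) \<in> carrier R" using eval_in_carrier[OF sc(3)[OF asc]] c(2) x by simp
  let ?n = "length qs"
  have cl: "c [^] ?n \<in> carrier R" "x [^] ?n \<in> carrier R" "eval qs x \<in> carrier R"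
    using c x eval_in_carrier[OF asc x] by auto
  \<comment> \<open>The monic relation is first proved up to the factor \<open>c\<close>, which is
    nonzero and cancels in the domain.\<close>
  have "c \<otimes> eval (\<one> # ?q) (c \<otimes> x) = c \<otimes> (c [^] ?n \<otimes> x [^] ?n) \<oplus> c \<otimes> eval ?q (c \<otimes> x)"
    using c x qc cl by (simp add: sc(2) nat_pow_distrib r_distr)
  also have "\<dots> = c [^] ?n \<otimes> (c \<otimes> x [^] ?n \<oplus> eval qs x)"
    unfolding sc(1)[OF asc] add_0 using c cl by algebra
  also have "\<dots> = \<zero>" using root cl by simp
  finally have "eval (\<one> # ?q) (c \<otimes> x) = \<zero>"
    using integral[of c "eval (\<one> # ?q) (c \<otimes> x)"] c eval_in_carrier[of "\<one> # ?q" "c \<otimes> x"] sc(3)[OF asc] x by simp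
  moreover have "\<one> # ?q \<in> carrier (univ_poly R D)"
    using q DE(3) univ_poly_carrier[of R D "\<one> # ?q"] unfolding polynomial_def by simp
  ultimately show ?thesis unfolding integral_over_def by (metis list.distinct(1) list.sel(1))
qed

lemma (in domain) submaximal_over_PID:
  assumes D: "subring D R"
    and PID: "principal_domain (R\<lparr>carrier := D\<rparr>)"
    and closed: "integrally_closed_in D R"
    and units: "Units R \<noteq> Units (R\<lparr>carrier := D\<rparr>)"
  shows "submaximal R"
proof -
  interpret D: principal_domain "R\<lparr>carrier := D\<rparr>" by fact
  have Dc: "a \<in> carrier R" if "a \<in> D" for a using subringE(1)[OF D] that by auto
  show ?thesis
  proof (cases "\<exists>c\<in>D. c \<in> Units R \<and> c \<notin> Units (R\<lparr>carrier := D\<rparr>)")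
    case True
    then obtain c where c: "c \<in> D" "c \<in> Units R" "c \<notin> Units (R\<lparr>carrier := D\<rparr>)" by auto
    have c0: "c \<noteq> \<zero>" using Units_r_inv[OF c(2)] Units_inv_closed[OF c(2)] by auto
    \<comment> \<open>An irreducible divisor \<open>b\<close> of \<open>c\<close> is prime in
      \<open>D\<close> and still invertible in \<open>R\<close>, with inverse
      \<open>e/c\<close>.\<close>
    obtain b where b: "b \<in> D" "ring_irreducible\<^bsub>R\<lparr>carrier := D\<rparr>\<^esub> b" "b divides\<^bsub>R\<lparr>carrier := D\<rparr>\<^esub> c"
      using conjI[OF c(1) c0] c(3) by (rule D.exists_irreducible_divisor[of c, simplified])
    from b(3) obtain e where e: "e \<in> D" "c = b \<otimes> e" unfolding factor_def by auto
    have "ring_prime\<^bsub>R\<lparr>carrier := D\<rparr>\<^esub> b" using D.primeness_condition[of b] b by simp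
    then have den: "denominators D b {w \<in> D. \<not> b divides\<^bsub>R\<lparr>carrier := D\<rparr>\<^esub> w}"
      using denominators_subring[OF D] D.prime_denominators[of b] b(1) by simp
    have "b \<otimes> (e \<otimes> inv c) = \<one>"
      using Units_r_inv[OF c(2)] Units_inv_closed[OF c(2)] b(1) e Dc by (simp add: m_assoc)
    then show ?thesis
      using submaximal_of_denominators[OF den, of "e \<otimes> inv c"] e(1) Dc Units_inv_closed[OF c(2)] by simp
  next
    case False
    have "Units (R\<lparr>carrier := D\<rparr>) \<subseteq> Units R"
      unfolding Units_def using Dc by auto
    \<comment> \<open>Units of \<open>D\<close> are units of \<open>R\<close>, so the unit groups
      can differ only through a unit of \<open>R\<close> that is not one of
      \<open>D\<close>.\<close>
    then obtain u where u: "u \<in> Units R" "u \<notin> Units (R\<lparr>carrier := D\<rparr>)" using units by auto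
    have uc: "u \<in> carrier R" "inv u \<in> carrier R" "u \<otimes> inv u = \<one>" using u(1) by auto
    have "(transcendental over D) u"
    proof (rule ccontr)
      assume "\<not> (transcendental over D) u"
      then have "(algebraic over D) u" unfolding over_def by simp
      then obtain q where q: "q \<in> carrier (univ_poly R D)" "q \<noteq> []" "eval q u = \<zero>"
        using algebraicE[OF D uc(1)] by blast
      then obtain c as where cas: "q = c # as" by (cases q) auto
      have pol: "polynomial D (c # as)" using q(1) univ_poly_carrier[of R D q] cas by simp
      then have c: "c \<in> D" "c \<noteq> \<zero>" unfolding polynomial_def by auto
      have "integral_over R D (c \<otimes> u)"
        using integral_lead_coeff_mult[OF D uc(1) pol] q(3) cas by simp
      then have d: "c \<otimes> u \<in> D"
        using closed m_closed[OF Dc[OF c(1)] uc(1)] unfolding integrally_closed_in_def by blast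
      define e where "e = c \<otimes> u"
      have e: "e \<in> D" using d unfolding e_def .
      obtain g c' d' x y where
        g: "g \<in> D" "c' \<in> D" "d' \<in> D" "x \<in> D" "y \<in> D" "g \<noteq> \<zero>" "c = g \<otimes> c'" "e = g \<otimes> d'"
        and bez: "x \<otimes> d' \<oplus> y \<otimes> c' = \<one>"
        using c e by (rule D.coprime_quotients[of c e, simplified])
      note gc = g(1-5)[THEN Dc]
      have "g \<otimes> (c' \<otimes> u) = g \<otimes> d'" using g(7,8)[symmetric] gc uc by (simp add: m_assoc[symmetric] e_def)
      then have cu: "c' \<otimes> u = d'" using m_lcancel[OF g(6), of "c' \<otimes> u" d'] gc uc by simp
      \<comment> \<open>Since \<open>c' u = d'\<close>, the Bezout identity becomes
        \<open>c' (x u + y) = 1\<close>, so \<open>c'\<close> is invertible in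
        \<open>R\<close>.\<close>
      have "c' \<otimes> (x \<otimes> u \<oplus> y) = x \<otimes> (c' \<otimes> u) \<oplus> y \<otimes> c'" using gc uc by algebra
      then have "c' \<otimes> (x \<otimes> u \<oplus> y) = \<one>" using cu bez by simp
      then have "c' \<in> Units R"
        using unit_factor[of c' "x \<otimes> u \<oplus> y"] gc uc by simp
      moreover have "d' \<in> Units R" using Units_m_closed[OF calculation u(1)] cu by simp
      \<comment> \<open>By the case assumption, elements of \<open>D\<close> invertible in
        \<open>R\<close> are units of \<open>D\<close>. Then \<open>u = d'/c'\<close> is a unit of
        \<open>D\<close>, contrary to its choice.\<close>
      ultimately have c'U: "c' \<in> Units (R\<lparr>carrier := D\<rparr>)" and d': "d' \<in> Units (R\<lparr>carrier := D\<rparr>)"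
        using False g(2,3) by blast+
      define r where "r = inv\<^bsub>R\<lparr>carrier := D\<rparr>\<^esub> c'"
      have r: "r \<in> Units (R\<lparr>carrier := D\<rparr>)" "r \<otimes> c' = \<one>"
        using D.Units_inv_Units[OF c'U] D.Units_l_inv[OF c'U] unfolding r_def by simp_all
      have rc: "r \<in> carrier R" using D.Units_closed[OF r(1)] Dc by simp
      have "u = (r \<otimes> c') \<otimes> u" using r(2) uc by simp
      also have "\<dots> = r \<otimes> d'" using cu rc gc uc by (simp add: m_assoc)
      finally have "u \<in> Units (R\<lparr>carrier := D\<rparr>)" using D.Units_m_closed[OF r(1) d'] by simp
      then show False using u(2) by simp
    qed
    then show ?thesis using submaximal_of_transcendental_unit[OF D uc] by simp
  qed
qed

theorem corollary1p14:
  fixes R :: "('a, 'b) ring_scheme" and D :: "'a set"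
  assumes "domain R"
    and "subring D R"
    and "principal_domain (R\<lparr>carrier := D\<rparr>)"
    and "integrally_closed_in D R"
    and "Units R \<noteq> Units (R\<lparr>carrier := D\<rparr>)"
  shows "submaximal R"
  by (rule domain.submaximal_over_PID[OF assms])

end
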